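(* Let the parameter space $\Theta$ be a Banach space with norm $\|\cdot\|$, let $\alpha\in\Theta$, and let $\mu,\mu'\in\mathcal P(E)$. Suppose that the function $$\Lambda_\theta(x)=\sup_{x'}\left|\frac{dL_\theta(x',\cdot)}{dK_\theta(x',\cdot)}(x)\right|$$ is well defined and $$\sup_{n>0}\ \sup_{\theta,\theta'\in\mathcal N(\alpha)}\Big(\mathbb E_{\mu,\theta}\big[\big(K_{\theta'}\Lambda_{\theta'}^{\,n+1}\big)(X_{n-1})\big]\Big)^{\frac1{n+1}}<+\infty$$ for some sufficiently small neighborhood $\mathcal N(\alpha)$ of $\alpha$. Then, if $K_\alpha$ is mixing and the first two moments of $\nu_\alpha$ exist, the optimal filters will almost surely be uniformly continuous with respect to the parameters, in the sense that $$\lim_{\theta\to\alpha}\sup_{n>0}\mathbb E_{\mu',\alpha}\|\Psi_n^\theta(\mu)-\Psi_n^\alpha(\mu)\|_{tv}=0 .$$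
   Context: Setting. $E$ is a Polish space with Borel $\sigma$-field $\mathcal B(E)$, $\mathcal P(E)$ is the set of probability measures on $E$, and $\mathcal C_b(E)$ the set of bounded continuous real functions on $E$. For each $\theta\in\Theta$, $K_\theta$ is a Feller transition probability kernel on $E$ that is mixing: there are a constant $0<\epsilon_\theta\le1$ and a finite nonnegative measure $\lambda_\theta$ on $E$ with $\epsilon_\theta\lambda_\theta(A)\le K_\theta(x,A)\le\frac1{\epsilon_\theta}\lambda_\theta(A)$ for all $x\in E$, $A\in\mathcal B(E)$. Under $\mathbb P_{\mu,\theta}$ (expectation $\mathbb E_{\mu,\theta}$), $(X_n)_{n\ge0}$ is a Markov chain with initial distribution $\mu$ and kernel $K_\theta$ (its law is $P_{\mu,\theta}$), and $Y_n=h(X_n)+V_n$, with $h:E\to\mathbb R^p$ bounded continuous and $(V_n)$ i.i.d. Gaussian$(0,\sigma^2)$ $\mathbb R^p$-valued random variables with density $g$, independent of $X$. $\mu_\theta$ is the unique limiting distribution of the Markov chain with kernel $K_\theta$, and $\nu_\theta=(\mu_\theta\circ h^{-1})\ast g$ is the limiting distribution of the observation process. The optimal filter with parameter $\theta$ and initial distribution $\mu$ is the random measure $$\Psi_n^\theta(\mu)(f)=\frac{\int_{E^n}f(x_n)\prod_{k=1}^ng(Y_k-h(x_k))P_{\mu,\theta}(dx_1,\dots,dx_n)}{\int_{E^n}\prod_{k=1}^ng(Y_k-h(x_k))P_{\mu,\theta}(dx_1,\dots,dx_n)},\qquad f\in\mathcal C_b(E).$$ $L_\theta:\mathcal C_b(E)\to\mathcal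 C_b(E)$ denotes the Fréchet derivative of the kernel $K_\theta$ with respect to the weak operator norm, i.e. $$\lim_{v\downarrow0}\left|\frac{m(K_{\theta+v}f)-m(K_\theta f)}{\|v\|}-m(L_\theta f)\right|=0,\qquad\forall m\in\mathcal P(E)\ \text{and}\ f\in\mathcal C_b(E),$$ and $L_\theta(x',dx)$ is the corresponding kernel, $L_\theta f(x')=\int_Ef(x)L_\theta(x',dx)$. For a function $\phi$ on $E$, $(K_{\theta'}\phi)(x)=\int_E\phi(y)K_{\theta'}(x,dy)$. $\|\cdot\|_{tv}$ is the total variation norm on the space of measures. *)

theory Defs
  imports "HOL-Probability.Probability"
begin

section \<open>Signed measures on the Borel sets\<close>

definition signed_measure :: "('e::topological_space set \<Rightarrow> real) \<Rightarrow> bool" where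
  "signed_measure \<nu> \<longleftrightarrow>
     (\<forall>A :: nat \<Rightarrow> 'e set. range A \<subseteq> sets borel \<and> disjoint_family A
        \<longrightarrow> (\<lambda>i. \<nu> (A i)) sums \<nu> (\<Union>i. A i))"

definition upper_variation :: "('e::topological_space set \<Rightarrow> real) \<Rightarrow> 'e set \<Rightarrow> ennreal" where
  "upper_variation \<nu> A = (SUP B\<in>{B \<in> sets borel. B \<subseteq> A}. ennreal (\<nu> B))"

text \<open>For a signed measure \<open>\<nu>\<close>, \<open>jordan_pos \<nu>\<close> is the positive part of its Jordan decomposition
  and \<open>jordan_pos (\<lambda>A. - \<nu> A)\<close> the negative part.\<close>

definition jordan_pos :: "('e::topological_space set \<Rightarrow> real) \<Rightarrow> 'e measure" where
  "jordan_pos \<nu> = measure_of UNIV (sets borel) (upper_variation \<nu>)"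

definition signed_integral :: "('e::topological_space set \<Rightarrow> real) \<Rightarrow> ('e \<Rightarrow> real) \<Rightarrow> real" where
  "signed_integral \<nu> f = (\<integral>x. f x \<partial>jordan_pos \<nu>) - (\<integral>x. f x \<partial>jordan_pos (\<lambda>A. - \<nu> A))"

text \<open>Normalised as the total mass of the variation measure, so that two mutually singular
  probability measures are at distance 2.\<close>

definition tv_norm :: "('e::topological_space set \<Rightarrow> real) \<Rightarrow> ennreal" where
  "tv_norm \<nu> = upper_variation \<nu> UNIV + upper_variation (\<lambda>A. - \<nu> A) UNIV"

text \<open>\<open>l\<close> is a version of the Radon--Nikodym derivative of the signed measure \<open>\<nu>\<close> with respect
  to \<open>M\<close>.\<close>

definition signed_RN_density ::
    "('e set \<Rightarrow> real) \<Rightarrow> 'e measure \<Rightarrow> ('e \<Rightarrow> real) \<Rightarrow> bool" where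
  "signed_RN_density \<nu> M l \<longleftrightarrow>
     integrable M l \<and> (\<forall>A\<in>sets M. \<nu> A = set_lebesgue_integral M A l)"

section \<open>Kernels\<close>

text \<open>\<open>space (prob_algebra borel)\<close> is the set of Borel probability measures, and \<open>bcontfun\<close> the set
  of bounded continuous functions.\<close>

definition feller_kernel :: "('e::polish_space \<Rightarrow> 'e measure) \<Rightarrow> bool" where
  "feller_kernel K \<longleftrightarrow> K \<in> borel \<rightarrow>\<^sub>M prob_algebra borel \<and>
     (\<forall>f\<in>bcontfun. (\<lambda>x. \<integral>y. (f y :: real) \<partial>K x) \<in> bcontfun)"

definition mixing_kernel :: "('e::polish_space \<Rightarrow> 'e measure) \<Rightarrow> bool" where
  "mixing_kernel K \<longleftrightarrow> (\<exists>\<epsilon> lam. 0 < \<epsilon> \<and> \<epsilon> \<le> 1 \<and> finite_measure lam \<and> sets lam = sets borel \<and>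
     (\<forall>x. \<forall>A\<in>sets borel. \<epsilon> * measure lam A \<le> measure (K x) A \<and>
                          measure (K x) A \<le> 1 / \<epsilon> * measure lam A))"

definition signed_kernel :: "('e::polish_space \<Rightarrow> 'e set \<Rightarrow> real) \<Rightarrow> bool" where
  "signed_kernel L \<longleftrightarrow> (\<forall>x. signed_measure (L x)) \<and>
     (\<forall>A\<in>sets borel. (\<lambda>x. L x A) \<in> borel_measurable borel)"

text \<open>\<open>L v\<close> is the Frechet derivative of \<open>K\<close> at \<open>\<theta>\<close> in the direction \<open>v\<close>, in the weak sense: for
  every probability measure \<open>m\<close> and bounded continuous \<open>f\<close>, the map \<open>\<eta> \<mapsto> m (K\<^sub>\<eta> f)\<close> is Frechet
  differentiable at \<open>\<theta>\<close> with derivative \<open>v \<mapsto> m (L\<^sub>v f)\<close>.  By linearity in \<open>v\<close> this says that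
  \<open>(m (K\<^sub>\<theta>\<^sub>+\<^sub>v f) - m (K\<^sub>\<theta> f)) / \<parallel>v\<parallel> - m (L\<^sub>v\<^sub>/\<^sub>\<parallel>\<^sub>v\<^sub>\<parallel> f)\<close> tends to 0 with \<open>v\<close>.  The
  dependence on the direction cannot be dropped: a derivative that is the same in all directions
  \<open>v\<close> and \<open>-v\<close>, at every \<open>\<theta>\<close>, forces \<open>K\<close> to be constant in the parameter.\<close>

definition weak_frechet_derivative ::
    "('p::real_normed_vector \<Rightarrow> 'e::polish_space \<Rightarrow> 'e measure) \<Rightarrow> 'p \<Rightarrow>
     ('p \<Rightarrow> 'e \<Rightarrow> 'e set \<Rightarrow> real) \<Rightarrow> bool" where
  "weak_frechet_derivative K \<theta> L \<longleftrightarrow>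
     (\<forall>v. signed_kernel (L v)) \<and>
     (\<forall>v. \<forall>f\<in>bcontfun. (\<lambda>x. signed_integral (L v x) f) \<in> bcontfun) \<and>
     (\<forall>m\<in>space (prob_algebra borel). \<forall>f\<in>bcontfun.
        ((\<lambda>\<eta>. \<integral>x. (\<integral>y. f y \<partial>K \<eta> x) \<partial>m) has_derivative
         (\<lambda>v. \<integral>x. signed_integral (L v x) f \<partial>m)) (at \<theta>))"

text \<open>With \<open>l v x' x = dL\<^sub>v(x',\<cdot>)/dK(x',\<cdot>)(x)\<close>, the absolute value of the derivative is its norm as a
  functional of the direction \<open>v\<close>; for a one-dimensional parameter it is \<open>\<bar>l 1 x' x\<bar>\<close>.\<close>

definition Lambda_fun :: "('p::real_normed_vector \<Rightarrow> 'e \<Rightarrow> 'e \<Rightarrow> real) \<Rightarrow> 'e \<Rightarrow> ennreal" where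
  "Lambda_fun l x = (SUP x'. SUP v\<in>{v. norm v = 1}. ennreal \<bar>l v x' x\<bar>)"

text \<open>Radon--Nikodym derivatives are only determined almost everywhere, whereas the supremum runs
  over possibly uncountably many \<open>x'\<close>; hence \<open>Lambda_fun\<close> being well defined refers to a given
  choice \<open>l\<close> of versions.\<close>

definition Lambda_well_defined ::
    "('p::real_normed_vector \<Rightarrow> 'e::polish_space \<Rightarrow> 'e set \<Rightarrow> real) \<Rightarrow> ('e \<Rightarrow> 'e measure) \<Rightarrow>
     ('p \<Rightarrow> 'e \<Rightarrow> 'e \<Rightarrow> real) \<Rightarrow> bool" where
  "Lambda_well_defined L K l \<longleftrightarrow>
     (\<forall>v x'. signed_RN_density (L v x') (K x') (l v x')) \<and>
     Lambda_fun l \<in> borel_measurable borel"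

definition ennreal_root :: "nat \<Rightarrow> ennreal \<Rightarrow> ennreal" where
  "ennreal_root n x = (if x = \<top> then \<top> else ennreal (root n (enn2real x)))"

section \<open>The hidden Markov model\<close>

definition past :: "'w measure \<Rightarrow> (nat \<Rightarrow> 'w \<Rightarrow> 'e::polish_space) \<Rightarrow> nat \<Rightarrow> 'w measure" where
  "past M X n = vimage_algebra (space M) (\<lambda>\<omega>. \<lambda>i\<in>{..n}. X i \<omega>) (\<Pi>\<^sub>M i\<in>{..n}. borel)"

definition markov_chain ::
    "'w measure \<Rightarrow> (nat \<Rightarrow> 'w \<Rightarrow> 'e::polish_space) \<Rightarrow> 'e measure \<Rightarrow> ('e \<Rightarrow> 'e measure) \<Rightarrow> bool" where
  "markov_chain M X m K \<longleftrightarrow>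
     prob_space M \<and> (\<forall>n. X n \<in> borel_measurable M) \<and> distr M borel (X 0) = m \<and>
     (\<forall>n. \<forall>A\<in>sets borel. AE \<omega> in M.
        real_cond_exp M (past M X n) (indicator (X (Suc n) -` A)) \<omega> = measure (K (X n \<omega>)) A)"

definition noise_density :: "real \<Rightarrow> real ^ 'd \<Rightarrow> real" where
  "noise_density \<sigma> z = (\<Prod>i\<in>UNIV. normal_density 0 \<sigma> (z $ i))"

definition hidden_markov_model ::
    "'w measure \<Rightarrow> (nat \<Rightarrow> 'w \<Rightarrow> 'e::polish_space) \<Rightarrow> (nat \<Rightarrow> 'w \<Rightarrow> real ^ 'd) \<Rightarrow>
     'e measure \<Rightarrow> ('e \<Rightarrow> 'e measure) \<Rightarrow> real \<Rightarrow> bool" where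
  "hidden_markov_model M X V m K \<sigma> \<longleftrightarrow>
     markov_chain M X m K \<and>
     (\<forall>n. distributed M lborel (V n) (\<lambda>z. ennreal (noise_density \<sigma> z))) \<and>
     prob_space.indep_vars M (\<lambda>_. borel) V UNIV \<and>
     prob_space.indep_set M
       (sets (vimage_algebra (space M) (\<lambda>\<omega> n. X n \<omega>) (\<Pi>\<^sub>M n\<in>UNIV. borel)))
       (sets (vimage_algebra (space M) (\<lambda>\<omega> n. V n \<omega>) (\<Pi>\<^sub>M n\<in>UNIV. borel)))"

definition observation ::
    "('e \<Rightarrow> real ^ 'd) \<Rightarrow> (nat \<Rightarrow> 'w \<Rightarrow> 'e) \<Rightarrow> (nat \<Rightarrow> 'w \<Rightarrow> real ^ 'd) \<Rightarrow> nat \<Rightarrow> 'w \<Rightarrow> real ^ 'd" where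
  "observation h X V n \<omega> = h (X n \<omega>) + V n \<omega>"

text \<open>\<open>P m\<close> is the law of the model started from \<open>m\<close>.  Convergence from every initial distribution
  to the same \<open>\<pi>\<close> makes \<open>\<pi>\<close> unique.\<close>

definition limiting_distribution ::
    "('e measure \<Rightarrow> 'w measure) \<Rightarrow> (nat \<Rightarrow> 'w \<Rightarrow> 'e::polish_space) \<Rightarrow> 'e measure \<Rightarrow> bool" where
  "limiting_distribution P X \<pi> \<longleftrightarrow> \<pi> \<in> space (prob_algebra borel) \<and>
     (\<forall>m\<in>space (prob_algebra borel). \<forall>f\<in>bcontfun.
        (\<lambda>n. \<integral>\<omega>. (f (X n \<omega>) :: real) \<partial>P m) \<longlonglongrightarrow> (\<integral>x. f x \<partial>\<pi>))"

definition observation_limit ::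
    "('e::polish_space \<Rightarrow> real ^ 'd) \<Rightarrow> real \<Rightarrow> 'e measure \<Rightarrow> (real ^ 'd) measure" where
  "observation_limit h \<sigma> \<pi> =
     convolution (distr \<pi> borel h) (density lborel (\<lambda>z. ennreal (noise_density \<sigma> z)))"

section \<open>The optimal filter\<close>

definition path_law ::
    "'w measure \<Rightarrow> (nat \<Rightarrow> 'w \<Rightarrow> 'e::polish_space) \<Rightarrow> nat \<Rightarrow> (nat \<Rightarrow> 'e) measure" where
  "path_law M X n = distr M (\<Pi>\<^sub>M k\<in>{1..n}. borel) (\<lambda>\<omega>. \<lambda>k\<in>{1..n}. X k \<omega>)"

text \<open>\<open>Q\<close> is the law of \<open>(X\<^sub>1,\<dots>,X\<^sub>n)\<close> and \<open>y\<close> the observed sequence.  The formula is used both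
  for bounded continuous \<open>f\<close> and, to obtain the filter as a measure, for indicators.\<close>

definition optimal_filter ::
    "(nat \<Rightarrow> 'e) measure \<Rightarrow> ('e \<Rightarrow> real ^ 'd) \<Rightarrow> real \<Rightarrow> nat \<Rightarrow> (nat \<Rightarrow> real ^ 'd) \<Rightarrow> ('e \<Rightarrow> real) \<Rightarrow> real" where
  "optimal_filter Q h \<sigma> n y f =
     (\<integral>x. f (x n) * (\<Prod>k=1..n. noise_density \<sigma> (y k - h (x k))) \<partial>Q) /
     (\<integral>x. (\<Prod>k=1..n. noise_density \<sigma> (y k - h (x k))) \<partial>Q)"

definition filter_measure ::
    "'w measure \<Rightarrow> (nat \<Rightarrow> 'w \<Rightarrow> 'e::polish_space) \<Rightarrow> ('e \<Rightarrow> real ^ 'd) \<Rightarrow> real \<Rightarrow> nat \<Rightarrow>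
     (nat \<Rightarrow> real ^ 'd) \<Rightarrow> 'e set \<Rightarrow> real" where
  "filter_measure M X h \<sigma> n y A = optimal_filter (path_law M X n) h \<sigma> n y (indicator A)"

end

theory Submission
  imports Defs
begin

text \<open>Mixing bounds the law of \<open>X\<^sub>n\<^sub>-\<^sub>1\<close> followed by \<open>K\<^sub>\<theta>\<close> from below by \<open>\<epsilon> \<lambda>\<close>, uniformly in \<open>n\<close>,
  so the uniform bound on the moments of order \<open>n + 1\<close> is a uniform bound \<open>C\<close> on the essential
  supremum of \<open>\<Lambda>\<^sub>\<theta>\<close>. Hence \<open>t \<mapsto> K\<^sub>\<alpha>\<^sub>+\<^sub>t\<^sub>v f(x)\<close> has logarithmic derivative in \<open>[-C, C]\<close> for \<open>f \<ge> 0\<close>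
  and \<open>\<parallel>v\<parallel> = 1\<close>, and \<open>K\<^sub>\<theta>(x,\<cdot>)\<close>, \<open>K\<^sub>\<alpha>(x,\<cdot>)\<close> agree up to a factor \<open>exp c\<close> with \<open>c = C \<parallel>\<theta> - \<alpha>\<parallel>\<close>.

  Measure the discrepancy of two unnormalised filters \<open>a\<close>, \<open>b\<close> by the least \<open>R\<close> with
  \<open>m b \<le> a \<le> R m b\<close> for some \<open>m > 0\<close>. Weighting both by a likelihood does not increase \<open>R\<close>; a step
  of the mixing kernel \<open>K\<^sub>\<alpha>\<close> replaces \<open>R - 1\<close> by at most \<open>(1 - \<epsilon>\<^sup>2) (R - 1)\<close>; exchanging \<open>K\<^sub>\<alpha>\<close> for
  \<open>K\<^sub>\<theta>\<close> in one of the filters costs a factor \<open>exp (2 c)\<close>. So \<open>R \<le> 1 + r\<close> persists in time as soon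
  as \<open>exp (2 c) (1 + (1 - \<epsilon>\<^sup>2) r) \<le> 1 + r\<close>, which for given \<open>r > 0\<close> holds for \<open>\<theta>\<close> near \<open>\<alpha>\<close>. The
  resulting bound \<open>2 r\<close> on the total variation distance holds for every observation path.\<close>

section \<open>Comparison of measures\<close>

lemma integral_le_of_measure_le:
  fixes f :: "'a \<Rightarrow> real"
  assumes fin: "finite_measure M" "finite_measure N" and sets: "sets M = sets N"
    and f: "f \<in> borel_measurable N" "\<And>x. 0 \<le> f x" "\<And>x. f x \<le> B"
    and c: "0 \<le> c" and le: "\<And>A. A \<in> sets N \<Longrightarrow> measure M A \<le> c * measure N A"
  shows "(\<integral>x. f x \<partial>M) \<le> c * (\<integral>x. f x \<partial>N)"
proof -
  interpret M: finite_measure M by fact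
  interpret N: finite_measure N by fact
  have fM: "f \<in> borel_measurable M" using f(1) by (simp cong: measurable_cong_sets add: sets)
  have int: "integrable N f" "integrable M f"
    using f fM by (auto intro!: M.integrable_const_bound[where B=B] N.integrable_const_bound[where B=B])
  \<comment> \<open>Sets outside the common \<sigma>-algebra have measure 0 on both sides, so the
    comparison holds for every \<open>A\<close> and becomes an inequality in the order on
    measures.\<close>
  have "emeasure M A \<le> emeasure (scale_measure (ennreal c) N) A" for A
    using le[of A] c
    by (cases "A \<in> sets N")
       (auto simp: M.emeasure_eq_measure N.emeasure_eq_measure ennreal_mult[symmetric]
         emeasure_notin_sets sets measure_notin_sets intro!: ennreal_leI)
  then have "(\<integral>\<^sup>+x. f x \<partial>M) \<le> (\<integral>\<^sup>+x. f x \<partial>scale_measure (ennreal c) N)"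
    using sets by (intro nn_integral_mono_measure) (auto simp: le_measure le_fun_def)
  also have "\<dots> = c * (\<integral>\<^sup>+x. f x \<partial>N)"
    using f by (subst nn_integral_scale_measure) auto
  finally show ?thesis
    using int f c by (simp add: nn_integral_eq_integral ennreal_mult[symmetric])
qed

text \<open>A Doeblin argument. Split off from \<open>F\<close> the constant
  \<open>\<epsilon> * t\<close>. The nonnegative remainder inherits the bounds \<open>m\<close> and
  \<open>R * m\<close>, while on the constant the two integrals have the exact ratio
  \<open>s\<close>, which lies between them. The constant carries at least the share
  \<open>\<epsilon>\<^sup>2\<close> of the integral of \<open>F\<close> under \<open>b\<close>, so
  both bounds move towards \<open>s\<close> by that share.\<close>

lemma mixing_contraction:
  fixes F :: "'a \<Rightarrow> real"
  assumes fin: "finite_measure a" "finite_measure b" and sets: "sets a = sets b"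
    and b: "0 < measure b (space b)" and m: "0 < m" and R: "0 \<le> R"
    and le: "\<And>A. A \<in> sets b \<Longrightarrow> m * measure b A \<le> measure a A"
            "\<And>A. A \<in> sets b \<Longrightarrow> measure a A \<le> R * m * measure b A"
    and F: "F \<in> borel_measurable b" "\<And>x. \<epsilon> * t \<le> F x" "\<And>x. F x \<le> 1 / \<epsilon> * t"
    and \<epsilon>: "0 < \<epsilon>" and t: "0 \<le> t"
  defines "s \<equiv> measure a (space a) / measure b (space b)"
  shows "(m + \<epsilon>\<^sup>2 * (s - m)) * (\<integral>x. F x \<partial>b) \<le> (\<integral>x. F x \<partial>a)"
    and "(\<integral>x. F x \<partial>a) \<le> (R * m - \<epsilon>\<^sup>2 * (R * m - s)) * (\<integral>x. F x \<partial>b)"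
proof -
  interpret a: finite_measure a by fact
  interpret b: finite_measure b by fact
  define u where "u x = F x - \<epsilon> * t" for x
  have Fa: "F \<in> borel_measurable a" using F(1) by (simp cong: measurable_cong_sets add: sets)
  have F0: "0 \<le> F x" for x using F(2)[of x] \<epsilon> t by (meson mult_nonneg_nonneg less_imp_le order_trans)
  have int: "integrable a F" "integrable b F"
    using F0 F Fa by (auto intro!: a.integrable_const_bound[where B="1 / \<epsilon> * t"] b.integrable_const_bound[where B="1 / \<epsilon> * t"])
  have u: "u \<in> borel_measurable b" "u \<in> borel_measurable a" "\<And>x. 0 \<le> u x" "\<And>x. u x \<le> 1/\<epsilon> * t - \<epsilon> * t"
    using F Fa by (auto simp: u_def[abs_def])
  have sp: "space a = space b" using sets by (rule sets_eq_imp_space_eq)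
  have ua: "(\<integral>x. u x \<partial>a) = (\<integral>x. F x \<partial>a) - \<epsilon> * t * measure a (space a)"
    and ub: "(\<integral>x. u x \<partial>b) = (\<integral>x. F x \<partial>b) - \<epsilon> * t * measure b (space b)"
    using int by (simp_all add: u_def)
  \<comment> \<open>The lower bound is the upper bound with the roles of \<open>a\<close> and
    \<open>b\<close> exchanged and the factor \<open>1/m\<close>.\<close>
  have "(\<integral>x. u x \<partial>b) \<le> 1/m * (\<integral>x. u x \<partial>a)"
    using le m by (intro integral_le_of_measure_le[OF fin(2,1) sets[symmetric] u(2,3,4)]) (auto simp: field_simps sets)
  then have 1: "m * (\<integral>x. u x \<partial>b) \<le> (\<integral>x. u x \<partial>a)" using m by (simp add: field_simps)
  have 2: "(\<integral>x. u x \<partial>a) \<le> R * m * (\<integral>x. u x \<partial>b)"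
    using le R m by (intro integral_le_of_measure_le[OF fin sets u(1,3,4)]) auto
  have sb: "measure a (space a) = s * measure b (space b)" using b by (simp add: s_def)
  have sm: "m \<le> s" "s \<le> R * m"
    using le[of "space b"] b by (simp_all add: s_def sp field_simps)
  \<comment> \<open>From here to \<open>B\<close>: since \<open>F\<close> is at most
    \<open>1/\<epsilon> * t\<close>, the constant \<open>\<epsilon> * t\<close> is at least
    \<open>\<epsilon>\<^sup>2\<close> times \<open>F\<close>. This is the share claimed for
    it.\<close>
  have "(\<integral>x. F x \<partial>b) \<le> (\<integral>x. 1/\<epsilon> * t \<partial>b)"
    using int F by (intro integral_mono) auto
  then have "\<epsilon>\<^sup>2 * (\<integral>x. F x \<partial>b) \<le> \<epsilon>\<^sup>2 * (1/\<epsilon> * t * measure b (space b))"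
    by (intro mult_left_mono) (auto simp: mult_ac)
  also have "\<dots> = \<epsilon> * t * measure b (space b)" using \<epsilon> by (simp add: power2_eq_square)
  finally have B: "\<epsilon>\<^sup>2 * (\<integral>x. F x \<partial>b) \<le> \<epsilon> * t * measure b (space b)" .
  have "(s - m) * (\<epsilon>\<^sup>2 * (\<integral>x. F x \<partial>b)) \<le> (s - m) * (\<epsilon> * t * measure b (space b))"
    using B sm by (intro mult_left_mono) auto
  with 1 show "(m + \<epsilon>\<^sup>2 * (s - m)) * (\<integral>x. F x \<partial>b) \<le> (\<integral>x. F x \<partial>a)"
    by (simp add: ua ub sb algebra_simps)
  have "(R * m - s) * (\<epsilon>\<^sup>2 * (\<integral>x. F x \<partial>b)) \<le> (R * m - s) * (\<epsilon> * t * measure b (space b))"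
    using B sm by (intro mult_left_mono) auto
  with 2 show "(\<integral>x. F x \<partial>a) \<le> (R * m - \<epsilon>\<^sup>2 * (R * m - s)) * (\<integral>x. F x \<partial>b)"
    by (simp add: ua ub sb algebra_simps)
qed

text \<open>The logarithm of the least such \<open>R\<close> is the Hilbert projective distance of
  \<open>a\<close> and \<open>b\<close>. The free factor \<open>m\<close> makes the relation blind
  to scaling, so unnormalised filters can be compared throughout.\<close>

definition comparable :: "real \<Rightarrow> 'a measure \<Rightarrow> 'a measure \<Rightarrow> bool" where
  "comparable R a b \<longleftrightarrow> (\<exists>m>0. \<forall>A\<in>sets b.
     m * measure b A \<le> measure a A \<and> measure a A \<le> R * m * measure b A)"

text \<open>One prediction step. \<open>F A\<close> stands for the transition probability into
  \<open>A\<close> under the mixing kernel; \<open>b'\<close> is the exact image of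
  \<open>b\<close>, and \<open>a'\<close> is the image of \<open>a\<close> up to a factor
  \<open>exp c\<close> either way. The image bounds \<open>m1\<close> and \<open>M1\<close> come
  from the contraction. The two-sided error spreads them to \<open>m1 * exp (- c)\<close> and
  \<open>M1 * exp c\<close>, hence the factor \<open>exp (2 * c)\<close> in the ratio.\<close>

lemma comparable_step:
  fixes F :: "'a set \<Rightarrow> 'a \<Rightarrow> real"
  assumes comp: "comparable R a b" and R: "1 \<le> R"
    and fin: "finite_measure a" "finite_measure b" and sets: "sets a = sets b" "sets b' = sets b"
    and b: "0 < measure b (space b)"
    and F: "\<And>A. A \<in> sets b \<Longrightarrow> F A \<in> borel_measurable b"
      "\<And>A x. A \<in> sets b \<Longrightarrow> \<epsilon> * lam A \<le> F A x" "\<And>A x. A \<in> sets b \<Longrightarrow> F A x \<le> 1 / \<epsilon> * lam A"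
    and \<epsilon>: "0 < \<epsilon>" "\<epsilon> \<le> 1" and lam: "\<And>A. A \<in> sets b \<Longrightarrow> 0 \<le> lam A"
    and a': "\<And>A. A \<in> sets b \<Longrightarrow> measure a' A \<le> exp c * (\<integral>x. F A x \<partial>a)"
      "\<And>A. A \<in> sets b \<Longrightarrow> (\<integral>x. F A x \<partial>a) \<le> exp c * measure a' A"
    and b': "\<And>A. A \<in> sets b \<Longrightarrow> measure b' A = (\<integral>x. F A x \<partial>b)"
    and R': "exp (2 * c) * (1 + (1 - \<epsilon>\<^sup>2) * (R - 1)) \<le> R'"
  shows "comparable R' a' b'"
proof -
  obtain m where m: "0 < m" "\<And>A. A \<in> sets b \<Longrightarrow> m * measure b A \<le> measure a A"
    "\<And>A. A \<in> sets b \<Longrightarrow> measure a A \<le> R * m * measure b A"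
    using comp by (auto simp: comparable_def)
  define s where "s = measure a (space a) / measure b (space b)"
  have R0: "0 \<le> R" using R by simp
  have sp: "space a = space b" using sets(1) by (rule sets_eq_imp_space_eq)
  have sm: "m \<le> s"
    using m(2)[of "space b"] b by (simp add: s_def sp field_simps)
  define m1 where "m1 = m + \<epsilon>\<^sup>2 * (s - m)"
  define M1 where "M1 = R * m - \<epsilon>\<^sup>2 * (R * m - s)"
  have m1: "m \<le> m1" using sm by (simp add: m1_def)
  have \<epsilon>2: "0 \<le> 1 - \<epsilon>\<^sup>2" using \<epsilon> by (simp add: power_le_one)
  \<comment> \<open>This product is exactly the right side minus the left side of \<open>M1\<close>
    below.\<close>
  have "0 \<le> \<epsilon>\<^sup>2 * (R - 1) * (1 - \<epsilon>\<^sup>2) * (s - m)"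
    using R \<epsilon>2 sm by simp
  then have M1: "M1 \<le> (1 + (1 - \<epsilon>\<^sup>2) * (R - 1)) * m1"
    by (simp add: M1_def m1_def algebra_simps)
  have "m1 * exp (- c) > 0" using m(1) m1 by simp
  moreover have "m1 * exp (- c) * measure b' A \<le> measure a' A"
    "measure a' A \<le> R' * (m1 * exp (- c)) * measure b' A" if A: "A \<in> sets b" for A
  proof -
    have *: "m1 * measure b' A \<le> (\<integral>x. F A x \<partial>a)" "(\<integral>x. F A x \<partial>a) \<le> M1 * measure b' A"
      unfolding b'[OF A] m1_def M1_def s_def
      by (rule mixing_contraction[OF fin sets(1) b m(1) R0 m(2,3) F(1)[OF A] F(2)[OF A] F(3)[OF A] \<epsilon>(1) lam[OF A]]; assumption)+
    have "m1 * exp (- c) * measure b' A \<le> exp (- c) * (\<integral>x. F A x \<partial>a)"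
      using *(1) by (simp add: mult_ac)
    also have "\<dots> \<le> exp (- c) * (exp c * measure a' A)" using a'(2)[OF A] by simp
    also have "\<dots> = measure a' A" by (simp flip: exp_add mult.assoc)
    finally show "m1 * exp (- c) * measure b' A \<le> measure a' A" .
    have "measure a' A \<le> exp c * (M1 * measure b' A)"
      by (rule order_trans[OF a'(1)[OF A]]) (use * in simp)
    also have "\<dots> \<le> exp c * ((1 + (1 - \<epsilon>\<^sup>2) * (R - 1)) * m1 * measure b' A)"
      using mult_right_mono[OF M1 measure_nonneg[of b' A]] by (simp add: mult.assoc)
    also have "\<dots> = exp (2 * c) * (1 + (1 - \<epsilon>\<^sup>2) * (R - 1)) * (m1 * exp (- c) * measure b' A)"
      by (simp add: exp_double power2_eq_square exp_minus)
    also have "\<dots> \<le> R' * (m1 * exp (- c) * measure b' A)"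
      using R' m1 m(1) by (intro mult_right_mono) auto
    finally show "measure a' A \<le> R' * (m1 * exp (- c)) * measure b' A" by (simp add: mult_ac)
  qed
  ultimately show ?thesis unfolding comparable_def sets(2) by blast
qed

lemma comparable_density:
  fixes w :: "'a \<Rightarrow> real"
  assumes comp: "comparable R a b" and R: "0 \<le> R"
    and fin: "finite_measure a" "finite_measure b" and sets: "sets a = sets b" "sets b' = sets b"
    and w: "w \<in> borel_measurable b" "\<And>x. 0 \<le> w x" "\<And>x. w x \<le> B"
    and a': "\<And>A. A \<in> sets b \<Longrightarrow> measure a' A = (\<integral>x. indicator A x * w x \<partial>a)"
    and b': "\<And>A. A \<in> sets b \<Longrightarrow> measure b' A = (\<integral>x. indicator A x * w x \<partial>b)"
  shows "comparable R a' b'"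
proof -
  obtain m where m: "0 < m" "\<And>A. A \<in> sets b \<Longrightarrow> m * measure b A \<le> measure a A"
    "\<And>A. A \<in> sets b \<Longrightarrow> measure a A \<le> R * m * measure b A"
    using comp by (auto simp: comparable_def)
  have "m * measure b' A \<le> measure a' A" "measure a' A \<le> R * m * measure b' A" if A: "A \<in> sets b" for A
  proof -
    have f: "(\<lambda>x. indicator A x * w x) \<in> borel_measurable b" "(\<lambda>x. indicator A x * w x) \<in> borel_measurable a"
      "\<And>x. 0 \<le> indicator A x * w x" "\<And>x. indicator A x * w x \<le> B"
      using A w(1,2,3) order_trans[OF w(2) w(3)]
      by (auto cong: measurable_cong_sets simp: sets indicator_def)
    have "measure b' A \<le> 1 / m * measure a' A"
      unfolding a'[OF A] b'[OF A] using m
      by (intro integral_le_of_measure_le[OF fin(2,1) sets(1)[symmetric] f(2,3,4)]) (auto simp: field_simps sets)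
    then show "m * measure b' A \<le> measure a' A" using m(1) by (simp add: field_simps)
    show "measure a' A \<le> R * m * measure b' A"
      unfolding a'[OF A] b'[OF A] using m R
      by (intro integral_le_of_measure_le[OF fin sets(1) f(1,3,4)]) auto
  qed
  with m(1) show ?thesis unfolding comparable_def sets(2) by blast
qed

text \<open>The total masses have a ratio between \<open>m\<close> and \<open>R * m\<close>, as do
  the measures of \<open>A\<close>. In the quotient the unknown \<open>m\<close> cancels, which
  leaves \<open>p \<le> R * q\<close> and \<open>q \<le> R * p\<close>; as \<open>p\<close> and
  \<open>q\<close> are at most 1, they differ by at most \<open>R - 1\<close>.\<close>

lemma comparable_normalized_diff:
  assumes comp: "comparable R a b" and fin: "finite_measure a" "finite_measure b"
    and sets: "sets a = sets b" and pos: "0 < measure a (space a)" "0 < measure b (space b)"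
    and A: "A \<in> sets b" and R: "1 \<le> R"
  shows "\<bar>measure a A / measure a (space a) - measure b A / measure b (space b)\<bar> \<le> R - 1"
proof -
  interpret a: finite_measure a by fact
  interpret b: finite_measure b by fact
  obtain m where m: "0 < m" "\<And>A. A \<in> sets b \<Longrightarrow> m * measure b A \<le> measure a A"
    "\<And>A. A \<in> sets b \<Longrightarrow> measure a A \<le> R * m * measure b A"
    using comp by (auto simp: comparable_def)
  have sp: "space a = space b" using sets by (rule sets_eq_imp_space_eq)
  define p where "p = measure a A / measure a (space a)"
  define q where "q = measure b A / measure b (space b)"
  have pq: "0 \<le> p" "p \<le> 1" "0 \<le> q" "q \<le> 1"
    using pos a.bounded_measure[of A] b.bounded_measure[of A] by (auto simp: p_def q_def)
  note s = m(2,3)[of "space b", simplified]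
  have "p \<le> (R * m * measure b A) / (m * measure b (space b))"
    unfolding p_def using m(1) m(3)[OF A] pos s(1) R
    by (intro frac_le) (auto simp: sp)
  then have 1: "p \<le> R * q" using m(1) by (simp add: q_def)
  have "(m * measure b A) / (m * measure b (space b)) \<le> measure a A / (measure a (space a) / R)"
    using m(1) m(2)[OF A] pos s(2) R by (intro frac_le) (auto simp: sp field_simps)
  then have 2: "q \<le> R * p" using m(1) by (simp add: q_def p_def mult.commute)
  have "(R - 1) * q \<le> R - 1" "(R - 1) * p \<le> R - 1" using pq R
    by (auto intro!: mult_left_le)
  with 1 2 show ?thesis unfolding p_def[symmetric] q_def[symmetric] by (auto simp: algebra_simps abs_le_iff)
qed

text \<open>The indicator of a closed set is the pointwise limit of continuous functions with values
  in [0, 1] that decay linearly in the distance to the set; dominated convergence carries the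
  inequality over.\<close>

lemma measure_closed_le_of_bcontfun_integral_le:
  fixes M1 M2 :: "'e::polish_space measure"
  assumes fin: "finite_measure M1" "finite_measure M2"
    and sets: "sets M1 = sets borel" "sets M2 = sets borel" and c: "0 \<le> c"
    and le: "\<And>f. f \<in> bcontfun \<Longrightarrow> (\<And>x. 0 \<le> f x) \<Longrightarrow> (\<integral>x. f x \<partial>M1) \<le> c * (\<integral>x. f x \<partial>M2 :: real)"
    and C: "closed C"
  shows "measure M1 C \<le> c * measure M2 C"
\<comment> \<open>\<open>infdist\<close> to the empty set is 0 by convention, so the approximating
  functions would be constantly 1 there.\<close>
proof (cases "C = {}")
  case False
  define f where "f n x = max 0 (1 - real n * infdist x C)" for n x
  have fc: "continuous_on UNIV (f n)" for n
    unfolding f_def by (intro continuous_intros)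
  have fb: "0 \<le> f n x" "f n x \<le> 1" for n x
    using infdist_nonneg[of x C] by (auto simp: f_def)
  have bc: "f n \<in> bcontfun" for n
    using fc fb by (auto simp: bcontfun_def intro!: boundedI[where B=1])
  have lim: "(\<lambda>n. f n x) \<longlonglongrightarrow> indicator C x" for x
  proof (cases "x \<in> C")
    case True
    then show ?thesis by (simp add: f_def)
  next
    case no: False
    then have d: "infdist x C > 0"
      using in_closed_iff_infdist_zero[OF C False] infdist_nonneg[of x C] by fastforce
    obtain N where "1 < real N * infdist x C" using reals_Archimedean3[OF d] by blast
    then have "f n x = 0" if "n \<ge> N" for n
    proof -
      have "real N * infdist x C \<le> real n * infdist x C" using that d by (intro mult_right_mono) auto
      then show ?thesis using \<open>1 < _\<close> by (simp add: f_def)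
    qed
    then have "eventually (\<lambda>n. f n x = indicator C x) sequentially"
      using no by (auto simp: eventually_sequentially)
    then show ?thesis by (rule tendsto_eventually)
  qed
  have conv: "(\<lambda>n. \<integral>x. f n x \<partial>M) \<longlonglongrightarrow> measure M C"
    if "finite_measure M" "sets M = sets borel" for M :: "'e measure"
  proof -
    interpret finite_measure M by fact
    have [measurable]: "C \<in> sets M" using C that by simp
    have [measurable]: "f n \<in> borel_measurable M" for n
      using borel_measurable_continuous_onI[OF fc] that(2) by (simp cong: measurable_cong_sets)
    have "(\<lambda>n. \<integral>x. f n x \<partial>M) \<longlonglongrightarrow> (\<integral>x. indicator C x \<partial>M)"
      using fb lim by (intro integral_dominated_convergence[where w="\<lambda>_. 1"]) auto
    then show ?thesis by (simp add: sets_eq_imp_space_eq[OF that(2)])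
  qed
  have "(\<lambda>n. c * (\<integral>x. f n x \<partial>M2)) \<longlonglongrightarrow> c * measure M2 C"
    using conv[OF fin(2) sets(2)] by (rule tendsto_mult_left)
  with conv[OF fin(1) sets(1)] show ?thesis
    using le[OF bc fb(1)] by (intro LIMSEQ_le[where X="\<lambda>n. \<integral>x. f n x \<partial>M1"]) auto
qed simp

text \<open>Finite Borel measures on a Polish space are inner regular, so \<open>A\<close> is
  exhausted by compact and hence closed subsets.\<close>

lemma measure_le_of_bcontfun_integral_le:
  fixes M1 M2 :: "'e::polish_space measure"
  assumes fin: "finite_measure M1" "finite_measure M2"
    and sets: "sets M1 = sets borel" "sets M2 = sets borel" and c: "0 \<le> c"
    and le: "\<And>f. f \<in> bcontfun \<Longrightarrow> (\<And>x. 0 \<le> f x) \<Longrightarrow> (\<integral>x. f x \<partial>M1) \<le> c * (\<integral>x. f x \<partial>M2 :: real)"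
    and A: "A \<in> sets borel"
  shows "measure M1 A \<le> c * measure M2 A"
proof -
  interpret M1: finite_measure M1 by fact
  interpret M2: finite_measure M2 by fact
  have "emeasure M1 A = (SUP C \<in> {C. C \<subseteq> A \<and> compact C}. emeasure M1 C)"
    using A sets by (intro inner_regular) auto
  also have "\<dots> \<le> ennreal (c * measure M2 A)"
  proof (rule SUP_least)
    fix C assume "C \<in> {C. C \<subseteq> A \<and> compact C}"
    then have "measure M1 C \<le> c * measure M2 C" "measure M2 C \<le> measure M2 A"
      using measure_closed_le_of_bcontfun_integral_le[OF fin sets c le] A sets
      by (auto intro!: M2.finite_measure_mono compact_imp_closed)
    then show "emeasure M1 C \<le> ennreal (c * measure M2 A)"
      unfolding M1.emeasure_eq_measure using c
      by (intro ennreal_leI) (meson mult_left_mono order_trans)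
  qed
  finally show ?thesis using c by (simp add: M1.emeasure_eq_measure ennreal_le_iff)
qed

section \<open>Domination of the derivative kernel\<close>

lemma upper_variation_density:
  assumes l: "signed_RN_density \<nu> M l" and sets: "sets M = sets borel" and A: "A \<in> sets borel"
  shows "upper_variation \<nu> A = emeasure (density M (\<lambda>x. ennreal (l x))) A"
proof -
  have int: "integrable M l" and \<nu>: "\<And>B. B \<in> sets borel \<Longrightarrow> \<nu> B = (\<integral>x. indicator B x * l x \<partial>M)"
    using l sets by (auto simp: signed_RN_density_def set_lebesgue_integral_def)
  have [measurable]: "l \<in> borel_measurable M" using int by auto
  have Ms: "B \<in> sets M" if "B \<in> sets borel" for B using that sets by simp
  have le: "ennreal (\<nu> B) \<le> (\<integral>\<^sup>+x. ennreal (l x) * indicator A x \<partial>M)"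
    if B: "B \<in> sets borel" "B \<subseteq> A" for B
  proof -
    have "integrable M (\<lambda>x. indicator B x * l x)"
      using integrable_mult_indicator[OF Ms[OF B(1)] int] by simp
    then have "(\<integral>x. indicator B x * l x \<partial>M) \<le> (\<integral>x. indicator B x * max 0 (l x) \<partial>M)"
      using integrable_mult_indicator[OF Ms[OF B(1)] integrable_max[OF integrable_zero int]]
      by (intro integral_mono) (auto simp: indicator_def)
    then have "ennreal (\<nu> B) \<le> ennreal (\<integral>x. indicator B x * max 0 (l x) \<partial>M)"
      using \<nu>[OF B(1)] by (simp add: ennreal_leI)
    also have "\<dots> = (\<integral>\<^sup>+x. ennreal (indicator B x * max 0 (l x)) \<partial>M)"
      using integrable_mult_indicator[OF Ms[OF B(1)] integrable_max[OF integrable_zero int]]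
      by (subst nn_integral_eq_integral) auto
    also have "\<dots> \<le> (\<integral>\<^sup>+x. ennreal (l x) * indicator A x \<partial>M)"
      using B(2) by (intro nn_integral_mono) (auto simp: indicator_def max_def ennreal_neg)
    finally show ?thesis .
  qed
  \<comment> \<open>The part of \<open>A\<close> in the positive Hahn set of \<open>\<nu>\<close>;
    the supremum is attained at it.\<close>
  define B where "B = A \<inter> {x \<in> space M. 0 \<le> l x}"
  have "B \<in> sets M" unfolding B_def using Ms[OF A] by measurable
  then have B: "B \<in> sets borel" "B \<subseteq> A" using sets by (auto simp: B_def)
  have "(\<integral>\<^sup>+x. ennreal (l x) * indicator A x \<partial>M) = (\<integral>\<^sup>+x. ennreal (indicator B x * l x) \<partial>M)"
    by (intro nn_integral_cong) (auto simp: indicator_def B_def ennreal_neg)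
  also have "\<dots> = ennreal (\<integral>x. indicator B x * l x \<partial>M)"
    using integrable_mult_indicator[OF Ms[OF B(1)] int]
    by (intro nn_integral_eq_integral) (auto simp: B_def indicator_def)
  also have "\<dots> = ennreal (\<nu> B)" using \<nu>[OF B(1)] by simp
  finally have eq: "(\<integral>\<^sup>+x. ennreal (l x) * indicator A x \<partial>M) = ennreal (\<nu> B)" .
  have "upper_variation \<nu> A = (\<integral>\<^sup>+x. ennreal (l x) * indicator A x \<partial>M)"
    unfolding upper_variation_def
  proof (rule antisym)
    show "(SUP B\<in>{B \<in> sets borel. B \<subseteq> A}. ennreal (\<nu> B)) \<le> (\<integral>\<^sup>+x. ennreal (l x) * indicator A x \<partial>M)"
      using le by (intro SUP_least) auto
    show "(\<integral>\<^sup>+x. ennreal (l x) * indicator A x \<partial>M) \<le> (SUP B\<in>{B \<in> sets borel. B \<subseteq> A}. ennreal (\<nu> B))"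
      unfolding eq using B by (intro SUP_upper) auto
  qed
  then show ?thesis using Ms[OF A] by (subst emeasure_density) auto
qed

text \<open>On the Borel sets the upper variation agrees with a genuine measure, and
  \<open>measure_of\<close> depends only on the values there; countable additivity comes with the
  density.\<close>

lemma jordan_pos_density:
  assumes l: "signed_RN_density \<nu> M l" and sets: "sets M = sets borel"
  shows "jordan_pos \<nu> = density M (\<lambda>x. ennreal (l x))"
proof -
  let ?D = "density M (\<lambda>x. ennreal (l x))"
  have ss: "sigma_sets UNIV (sets (borel :: 'a measure)) = sets borel"
    using sets.sigma_sets_eq[of "borel :: 'a measure"] by (simp only: space_borel)
  have "jordan_pos \<nu> = measure_of UNIV (sets borel) (emeasure ?D)"
    unfolding jordan_pos_def
    by (rule measure_of_eq) (simp_all only: ss upper_variation_density[OF l sets] Pow_UNIV subset_UNIV)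
  also have "\<dots> = measure_of (space ?D) (sets ?D) (emeasure ?D)"
    using sets sets_eq_imp_space_eq[OF sets] by simp
  finally show ?thesis by (simp only: measure_of_of_measure)
qed

lemma signed_integral_density:
  assumes l: "signed_RN_density \<nu> M l" and sets: "sets M = sets borel"
    and f: "f \<in> borel_measurable borel" "\<And>x. \<bar>f x\<bar> \<le> B"
  shows "signed_integral \<nu> f = (\<integral>x. f x * l x \<partial>M)" "integrable M (\<lambda>x. f x * l x)"
proof -
  have int: "integrable M l" using l by (simp add: signed_RN_density_def)
  have lm[measurable]: "l \<in> borel_measurable M" using int by auto
  have fm[measurable]: "f \<in> borel_measurable M" using f sets by (simp cong: measurable_cong_sets)
  have l': "signed_RN_density (\<lambda>A. - \<nu> A) M (\<lambda>x. - l x)"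
    using l by (auto simp: signed_RN_density_def set_lebesgue_integral_def)
  \<comment> \<open>\<open>ennreal\<close> sends negative numbers to 0, so a density with respect to
    \<open>ennreal (t x)\<close> is one with respect to the positive part of
    \<open>t\<close>.\<close>
  have mx: "ennreal (t x) = ennreal (max 0 (t x))" for t :: "'a \<Rightarrow> real" and x
    by (auto simp: max_def ennreal_neg)
  have bd: "integrable M (\<lambda>x. t x * f x)" if "integrable M t" for t
  proof (rule Bochner_Integration.integrable_bound[where f="\<lambda>x. B * t x"])
    show "AE x in M. norm (t x * f x) \<le> norm (B * t x)"
    proof (rule AE_I2)
      fix x
      have "\<bar>t x\<bar> * \<bar>f x\<bar> \<le> \<bar>t x\<bar> * \<bar>B\<bar>"
        using f(2)[of x] by (intro mult_left_mono) auto
      then show "norm (t x * f x) \<le> norm (B * t x)" by (simp add: abs_mult mult.commute)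
    qed
  qed (use that in auto)
  show "integrable M (\<lambda>x. f x * l x)" using bd[OF int] by (simp add: mult.commute)
  have d: "(\<integral>x. f x \<partial>density M (\<lambda>x. ennreal (t x))) = (\<integral>x. max 0 (t x) * f x \<partial>M)"
    if [measurable]: "t \<in> borel_measurable M" for t
    unfolding mx by (subst integral_density) auto
  have "signed_integral \<nu> f = (\<integral>x. max 0 (l x) * f x \<partial>M) - (\<integral>x. max 0 (- l x) * f x \<partial>M)"
    unfolding signed_integral_def jordan_pos_density[OF l sets] jordan_pos_density[OF l' sets]
    by (simp add: d)
  also have "\<dots> = (\<integral>x. max 0 (l x) * f x - max 0 (- l x) * f x \<partial>M)"
    using int by (intro Bochner_Integration.integral_diff[symmetric] bd) auto
  also have "\<dots> = (\<integral>x. f x * l x \<partial>M)"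
    by (intro Bochner_Integration.integral_cong) (auto simp: max_def)
  finally show "signed_integral \<nu> f = (\<integral>x. f x * l x \<partial>M)" .
qed

section \<open>From moment bounds of growing order to an essential bound\<close>

lemma ennreal_root_leD:
  assumes "ennreal_root n x \<le> ennreal C" "0 \<le> C" "0 < n"
  shows "x \<le> ennreal (C ^ n)"
proof (cases x)
  case (real r)
  then have "root n r \<le> C" using assms by (simp add: ennreal_root_def)
  then have "(root n r) ^ n \<le> C ^ n" using real assms by (intro power_mono) auto
  then show ?thesis using real assms by (simp add: ennreal_leI)
next
  case top
  then show ?thesis using assms by (simp add: ennreal_root_def top_unique)
qed

text \<open>Markov's inequality on the set \<open>D\<close> where \<open>G\<close> exceeds
  \<open>C + 1\<close>. Mixing gives \<open>D\<close> at least the mass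
  \<open>\<epsilon> * measure lam D\<close> from every starting point, so the law of
  \<open>Z n\<close> drops out, and the moment of order \<open>n + 1\<close> forces this mass below
  \<open>(C / (C + 1)) ^ (n + 1)\<close>. Letting \<open>n\<close> grow makes \<open>D\<close> null
  for \<open>lam\<close>, and by the upper mixing bound for every \<open>K x\<close>.\<close>

lemma mixing_AE_le_of_moment_bound:
  fixes K :: "'e::polish_space \<Rightarrow> 'e measure"
  assumes mix: "mixing_kernel K" and K: "\<And>x. sets (K x) = sets borel" "\<And>x. prob_space (K x)"
    and [measurable]: "G \<in> borel_measurable borel" and M: "prob_space M" and C: "0 \<le> C"
    and le: "\<And>n. 0 < n \<Longrightarrow>
      ennreal_root (n + 1) (\<integral>\<^sup>+\<omega>. (\<integral>\<^sup>+y. G y ^ (n + 1) \<partial>K (Z n \<omega>)) \<partial>M) \<le> ennreal C"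
  shows "AE y in K x. G y \<le> ennreal (C + 1)"
proof -
  interpret M: prob_space M by fact
  obtain \<epsilon> lam where \<epsilon>: "0 < \<epsilon>" "\<epsilon> \<le> 1"
    and lam: "\<And>x A. A \<in> sets borel \<Longrightarrow> \<epsilon> * measure lam A \<le> measure (K x) A"
      "\<And>x A. A \<in> sets borel \<Longrightarrow> measure (K x) A \<le> 1 / \<epsilon> * measure lam A"
    using mix unfolding mixing_kernel_def by blast
  \<comment> \<open>The level must lie strictly above \<open>C\<close> for the ratio of powers to
    tend to 0; adding 1 also keeps the denominator positive when \<open>C\<close> is 0.\<close>
  define D where "D = {y \<in> space borel. ennreal (C + 1) < G y}"
  have D[measurable]: "D \<in> sets borel" unfolding D_def by measurable
  have bound: "\<epsilon> * measure lam D \<le> (C / (C + 1)) ^ (n + 1)" if n: "0 < n" for n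
  proof -
    have "ennreal ((C + 1) ^ (n + 1) * (\<epsilon> * measure lam D)) \<le> (\<integral>\<^sup>+y. G y ^ (n + 1) \<partial>K z)" for z
    proof -
      interpret K: prob_space "K z" by (rule K)
      have "ennreal ((C + 1) ^ (n + 1) * (\<epsilon> * measure lam D)) \<le> ennreal ((C + 1) ^ (n + 1) * measure (K z) D)"
        using C lam(1)[OF D] by (intro ennreal_leI mult_left_mono) auto
      also have "\<dots> = (\<integral>\<^sup>+y. ennreal ((C + 1) ^ (n + 1)) * indicator D y \<partial>K z)"
        using C K(1) by (simp add: nn_integral_cmult_indicator K.emeasure_eq_measure ennreal_mult)
      also have "\<dots> \<le> (\<integral>\<^sup>+y. G y ^ (n + 1) \<partial>K z)"
      proof (rule nn_integral_mono)
        fix y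
        show "ennreal ((C + 1) ^ (n + 1)) * indicator D y \<le> G y ^ (n + 1)"
        proof (cases "y \<in> D")
          case True
          then have "ennreal (C + 1) \<le> G y" by (simp add: D_def)
          then have "ennreal (C + 1) ^ (n + 1) \<le> G y ^ (n + 1)" by (rule power_mono) simp
          then show ?thesis using True C by (simp add: ennreal_power[symmetric] del: power_Suc)
        qed simp
      qed
      finally show ?thesis .
    qed
    then have "(\<integral>\<^sup>+\<omega>. ennreal ((C + 1) ^ (n + 1) * (\<epsilon> * measure lam D)) \<partial>M)
        \<le> (\<integral>\<^sup>+\<omega>. (\<integral>\<^sup>+y. G y ^ (n + 1) \<partial>K (Z n \<omega>)) \<partial>M)"
      by (intro nn_integral_mono)
    also have "\<dots> \<le> ennreal (C ^ (n + 1))"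
      using le[OF n] C by (intro ennreal_root_leD) auto
    finally have "(C + 1) ^ (n + 1) * (\<epsilon> * measure lam D) \<le> C ^ (n + 1)"
      using C by (simp add: M.emeasure_space_1 del: power_Suc)
    then show ?thesis using C by (simp add: power_divide pos_le_divide_eq mult.commute del: power_Suc)
  qed
  have "(\<lambda>n. (C / (C + 1)) ^ Suc n) \<longlonglongrightarrow> 0"
    using C by (intro LIMSEQ_Suc LIMSEQ_realpow_zero) auto
  then have "\<epsilon> * measure lam D \<le> 0"
    using bound by (intro LIMSEQ_le_const) (auto intro!: exI[of _ 1] simp: Suc_le_eq)
  then have "measure lam D \<le> 0" using \<epsilon> by (simp add: mult_le_0_iff)
  then have "measure lam D = 0" using measure_nonneg[of lam D] by linarith
  then have "measure (K x) D = 0" using lam(2)[OF D, of x] measure_nonneg[of "K x" D] by simp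
  then have "emeasure (K x) D = 0"
    using K(2)[of x] by (simp add: prob_space_def finite_measure.emeasure_eq_measure)
  moreover have "D = {y \<in> space (K x). \<not> G y \<le> ennreal (C + 1)}"
    by (auto simp: D_def sets_eq_imp_space_eq[OF K(1)] not_le)
  ultimately show ?thesis using D K(1)
    by (intro AE_I[where N=D]) auto
qed

lemma abs_signed_integral_le:
  assumes l: "signed_RN_density \<nu> M l" and sets: "sets M = sets borel" and fin: "finite_measure M"
    and f: "f \<in> borel_measurable borel" "\<And>x. 0 \<le> f x" "\<And>x. f x \<le> B"
    and le: "AE y in M. \<bar>l y\<bar> \<le> C"
  shows "\<bar>signed_integral \<nu> f\<bar> \<le> C * (\<integral>x. f x \<partial>M)"
proof -
  interpret finite_measure M by fact
  have fm[measurable]: "f \<in> borel_measurable M" using f sets by (simp cong: measurable_cong_sets)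
  have B: "\<bar>f x\<bar> \<le> B" for x using f by simp
  have "\<bar>signed_integral \<nu> f\<bar> = \<bar>\<integral>x. f x * l x \<partial>M\<bar>"
    using signed_integral_density[OF l sets f(1) B] by simp
  also have "\<dots> \<le> (\<integral>x. \<bar>f x * l x\<bar> \<partial>M)" by (rule integral_abs_bound)
  also have "\<dots> \<le> (\<integral>x. C * f x \<partial>M)"
  proof (rule integral_mono_AE)
    show "integrable M (\<lambda>x. \<bar>f x * l x\<bar>)"
      using signed_integral_density(2)[OF l sets f(1) B] by simp
    show "integrable M (\<lambda>x. C * f x)"
      using B by (intro integrable_mult_right integrable_const_bound[where B=B]) auto
    show "AE x in M. \<bar>f x * l x\<bar> \<le> C * f x"
      using le by eventually_elim
        (simp add: abs_mult f(2) mult.commute[of C] mult_left_mono)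
  qed
  finally show ?thesis by simp
qed

text \<open>The derivative bound makes \<open>exp (- C * t) * g t\<close> nonincreasing and
  \<open>exp (C * t) * g t\<close> nondecreasing on [0, \<open>T\<close>].\<close>

lemma gronwall_two_sided:
  fixes g g' :: "real \<Rightarrow> real"
  assumes d: "\<And>t. 0 \<le> t \<Longrightarrow> t \<le> T \<Longrightarrow> (g has_real_derivative g' t) (at t)"
    and le: "\<And>t. 0 \<le> t \<Longrightarrow> t \<le> T \<Longrightarrow> \<bar>g' t\<bar> \<le> C * g t" and T: "0 \<le> T"
  shows "g T \<le> exp (C * T) * g 0" "g 0 \<le> exp (C * T) * g T"
proof -
  have "exp (- C * T) * g T \<le> exp (- C * 0) * g 0"
  proof (rule DERIV_nonpos_imp_nonincreasing[OF T])
    fix t assume t: "0 \<le> t" "t \<le> T"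
    have "((\<lambda>t. exp (- C * t) * g t) has_real_derivative exp (- C * t) * (g' t - C * g t)) (at t)"
      using d[OF t] by (auto intro!: derivative_eq_intros simp: algebra_simps)
    moreover have "exp (- C * t) * (g' t - C * g t) \<le> 0"
      using le[OF t] by (simp add: mult_le_0_iff)
    ultimately show "\<exists>y. ((\<lambda>t. exp (- C * t) * g t) has_real_derivative y) (at t) \<and> y \<le> 0" by blast
  qed
  then show "g T \<le> exp (C * T) * g 0" by (simp add: exp_minus field_simps)
  have "exp (C * 0) * g 0 \<le> exp (C * T) * g T"
  proof (rule DERIV_nonneg_imp_nondecreasing[OF T])
    fix t assume t: "0 \<le> t" "t \<le> T"
    have "((\<lambda>t. exp (C * t) * g t) has_real_derivative exp (C * t) * (g' t + C * g t)) (at t)"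
      using d[OF t] by (auto intro!: derivative_eq_intros simp: algebra_simps)
    moreover have "exp (C * t) * (g' t + C * g t) \<ge> 0"
      using le[OF t] by (simp add: zero_le_mult_iff)
    ultimately show "\<exists>y. ((\<lambda>t. exp (C * t) * g t) has_real_derivative y) (at t) \<and> y \<ge> 0" by blast
  qed
  then show "g 0 \<le> exp (C * T) * g T" by simp
qed

text \<open>Testing the weak derivative with the Dirac measure at \<open>x\<close> makes it a
  derivative at the point \<open>x\<close>.\<close>

lemma weak_frechet_derivative_at:
  assumes K: "\<And>\<theta>. feller_kernel (K \<theta>)" and D: "weak_frechet_derivative K \<theta> L" and f: "f \<in> bcontfun"
  shows "((\<lambda>\<eta>. \<integral>y. f y \<partial>K \<eta> x) has_derivative (\<lambda>v. signed_integral (L v x) f)) (at \<theta>)"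
proof -
  have bm: "g \<in> borel_measurable borel" if "g \<in> bcontfun" for g :: "'b \<Rightarrow> real"
    using that by (auto simp: bcontfun_def intro: borel_measurable_continuous_onI)
  have r: "return borel x \<in> space (prob_algebra borel)"
    by (simp add: space_prob_algebra prob_space_return)
  have i: "(\<integral>z. g z \<partial>return borel x) = g x" if "g \<in> bcontfun" for g :: "'b \<Rightarrow> real"
    using bm[OF that] by (intro integral_return) auto
  have "((\<lambda>\<eta>. \<integral>z. (\<integral>y. f y \<partial>K \<eta> z) \<partial>return borel x) has_derivative
         (\<lambda>v. \<integral>z. signed_integral (L v z) f \<partial>return borel x)) (at \<theta>)"
    using D r f by (auto simp: weak_frechet_derivative_def)
  moreover have "(\<integral>z. (\<integral>y. f y \<partial>K \<eta> z) \<partial>return borel x) = (\<integral>y. f y \<partial>K \<eta> x)" for \<eta>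
    using K f by (intro i) (auto simp: feller_kernel_def)
  moreover have "(\<integral>z. signed_integral (L v z) f \<partial>return borel x) = signed_integral (L v x) f" for v
    using D f by (intro i) (auto simp: weak_frechet_derivative_def)
  ultimately show ?thesis by simp
qed

text \<open>Follow the straight segment from \<alpha> to \<theta>, which stays in the ball. Along it
  the integral of \<open>f\<close> is a real function whose derivative is controlled by its own
  value, so the two-sided Gronwall estimate applies.\<close>

lemma kernel_integral_ratio:
  fixes K :: "'p::real_normed_vector \<Rightarrow> 'e::polish_space \<Rightarrow> 'e measure"
  assumes K: "\<And>\<theta>. feller_kernel (K \<theta>)" and D: "\<And>\<theta>. weak_frechet_derivative K \<theta> (L \<theta>)"
    and bound: "\<And>\<eta> v. \<eta> \<in> ball \<alpha> \<delta> \<Longrightarrow> norm v = 1 \<Longrightarrow>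
      \<bar>signed_integral (L \<eta> v x) f\<bar> \<le> C * (\<integral>y. f y \<partial>K \<eta> x)"
    and \<theta>: "\<theta> \<in> ball \<alpha> \<delta>" and f: "f \<in> bcontfun"
  shows "(\<integral>y. f y \<partial>K \<theta> x) \<le> exp (C * dist \<alpha> \<theta>) * (\<integral>y. f y \<partial>K \<alpha> x)"
    and "(\<integral>y. f y \<partial>K \<alpha> x) \<le> exp (C * dist \<alpha> \<theta>) * (\<integral>y. f y \<partial>K \<theta> x)"
proof -
  define T where "T = dist \<alpha> \<theta>"
  have "(\<integral>y. f y \<partial>K \<theta> x) \<le> exp (C * T) * (\<integral>y. f y \<partial>K \<alpha> x) \<and>
        (\<integral>y. f y \<partial>K \<alpha> x) \<le> exp (C * T) * (\<integral>y. f y \<partial>K \<theta> x)"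
  proof (cases "\<theta> = \<alpha>")
    case False
    \<comment> \<open>Unit speed: the hypothesis on directions of norm 1 applies to
      \<open>v\<close>, and the parameter length \<open>T\<close> is the distance from \<alpha> to
      \<theta>.\<close>
    define v where "v = (\<theta> - \<alpha>) /\<^sub>R T"
    have T: "0 < T" "T = norm (\<theta> - \<alpha>)" using False by (auto simp: T_def dist_norm norm_minus_commute)
    then have v: "norm v = 1" by (simp add: v_def)
    define g where "g t = (\<integral>y. f y \<partial>K (\<alpha> + t *\<^sub>R v) x)" for t
    define g' where "g' t = signed_integral (L (\<alpha> + t *\<^sub>R v) v x) f" for t
    have in_ball: "\<alpha> + t *\<^sub>R v \<in> ball \<alpha> \<delta>" if "0 \<le> t" "t \<le> T" for t
      using that v \<theta> by (simp add: dist_norm T_def)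
    have d: "(g has_real_derivative g' t) (at t)" for t
    proof -
      let ?S = "\<lambda>w. signed_integral (L (\<alpha> + t *\<^sub>R v) w x) f"
      have G: "((\<lambda>\<eta>. \<integral>y. f y \<partial>K \<eta> x) has_derivative ?S) (at (\<alpha> + t *\<^sub>R v))"
        by (rule weak_frechet_derivative_at[OF K D f])
      have "((\<lambda>t. \<alpha> + t *\<^sub>R v) has_derivative (\<lambda>s. s *\<^sub>R v)) (at t)"
        by (auto intro!: derivative_eq_intros)
      from has_derivative_compose[OF this G]
      have "(g has_derivative (\<lambda>s. ?S (s *\<^sub>R v))) (at t)" by (simp add: g_def[abs_def])
      \<comment> \<open>Linearity of the Frechet derivative turns the derivative along the line into
        the value in the direction \<open>v\<close> times \<open>s\<close>.\<close>
      moreover have "?S (s *\<^sub>R v) = g' t * s" for s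
        using linear_cmul[OF has_derivative_linear[OF G], of s v] by (simp add: g'_def)
      ultimately show ?thesis by (simp add: has_field_derivative_def)
    qed
    have le: "\<bar>g' t\<bar> \<le> C * g t" if "0 \<le> t" "t \<le> T" for t
      unfolding g_def g'_def by (rule bound[OF in_ball[OF that] v])
    have "\<alpha> + T *\<^sub>R v = \<theta>" using T by (simp add: v_def)
    then show ?thesis
      using gronwall_two_sided[of T g g' C, OF d le] T(1) by (simp add: g_def)
  qed (simp add: T_def)
  then show "(\<integral>y. f y \<partial>K \<theta> x) \<le> exp (C * dist \<alpha> \<theta>) * (\<integral>y. f y \<partial>K \<alpha> x)"
    "(\<integral>y. f y \<partial>K \<alpha> x) \<le> exp (C * dist \<alpha> \<theta>) * (\<integral>y. f y \<partial>K \<theta> x)"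
    by (auto simp: T_def)
qed

section \<open>Filters of weighted Markov chains\<close>

text \<open>With the product of likelihoods up to time n as \<open>W\<close>, this is the
  unnormalised filter for \<open>Z\<close> the state at time n, and the unnormalised one-step
  predictor for \<open>Z\<close> the state at time n + 1.\<close>

definition weighted_law :: "'w measure \<Rightarrow> ('w \<Rightarrow> 'e::topological_space) \<Rightarrow> ('w \<Rightarrow> real) \<Rightarrow> 'e measure" where
  "weighted_law M Z W = distr (density M (\<lambda>\<omega>. ennreal (W \<omega>))) borel Z"

lemma weighted_law:
  assumes "finite_measure M" and [measurable]: "Z \<in> borel_measurable M" "W \<in> borel_measurable M"
    and W: "\<And>\<omega>. 0 \<le> W \<omega>" "\<And>\<omega>. W \<omega> \<le> B"
  shows finite_measure_weighted_law: "finite_measure (weighted_law M Z W)"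
    and sets_weighted_law: "sets (weighted_law M Z W) = sets borel"
    and integral_weighted_law: "f \<in> borel_measurable borel \<Longrightarrow>
      (\<integral>x. f x \<partial>weighted_law M Z W) = (\<integral>\<omega>. W \<omega> * f (Z \<omega>) \<partial>M :: real)"
    and measure_weighted_law: "A \<in> sets borel \<Longrightarrow>
      measure (weighted_law M Z W) A = (\<integral>\<omega>. W \<omega> * indicator A (Z \<omega>) \<partial>M)"
proof -
  interpret finite_measure M by fact
  have "emeasure (density M (\<lambda>\<omega>. ennreal (W \<omega>))) (space M) \<noteq> \<infinity>"
  proof -
    have "integrable M W" using W by (intro integrable_const_bound[where B=B]) auto
    then show ?thesis using W
      by (subst emeasure_density) (auto simp: nn_integral_eq_integral cong: nn_integral_cong_simp)
  qed
  then have "finite_measure (density M (\<lambda>\<omega>. ennreal (W \<omega>)))" by (intro finite_measureI) auto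
  then show fin: "finite_measure (weighted_law M Z W)"
    unfolding weighted_law_def by (rule finite_measure.finite_measure_distr) auto
  show s: "sets (weighted_law M Z W) = sets borel" by (simp add: weighted_law_def)
  show int: "(\<integral>x. f x \<partial>weighted_law M Z W) = (\<integral>\<omega>. W \<omega> * f (Z \<omega>) \<partial>M)"
    if [measurable]: "f \<in> borel_measurable borel" for f :: "'b \<Rightarrow> real"
    unfolding weighted_law_def using W
    by (subst integral_distr) (auto simp: integral_density)
  show "measure (weighted_law M Z W) A = (\<integral>\<omega>. W \<omega> * indicator A (Z \<omega>) \<partial>M)" if A: "A \<in> sets borel"
  proof -
    have "measure (weighted_law M Z W) A = (\<integral>x. indicator A x \<partial>weighted_law M Z W)"
      using sets_eq_imp_space_eq[OF s] by simp
    also have "\<dots> = (\<integral>\<omega>. W \<omega> * indicator A (Z \<omega>) \<partial>M)" using A by (intro int) auto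
    finally show ?thesis .
  qed
qed

section \<open>The Markov property and the filter recursion\<close>

lemma measure_kernel_measurable:
  assumes K: "K \<in> borel \<rightarrow>\<^sub>M prob_algebra borel" and A: "A \<in> sets borel"
  shows "(\<lambda>x. measure (K x) A) \<in> borel_measurable borel"
  using measurable_compose[OF measurable_prob_algebraD[OF K] measurable_measure_subprob_algebra[OF A]] .

lemma past_measurable_component:
  assumes "k \<le> n"
  shows "X k \<in> borel_measurable (past M X n)"
proof -
  have "(\<lambda>\<omega>. \<lambda>i\<in>{..n}. X i \<omega>) \<in> past M X n \<rightarrow>\<^sub>M (\<Pi>\<^sub>M i\<in>{..n}. borel)"
    unfolding past_def by (rule measurable_vimage_algebra1) (auto simp: space_PiM)
  from measurable_compose[OF this measurable_component_singleton[of k "{..n}" "\<lambda>_. borel"]]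
  show ?thesis using assms by simp
qed

text \<open>As \<open>W\<close> depends only on the past, the defining property of conditional
  expectation lets the transition probability replace the indicator under the integral.\<close>

lemma markov_chain_weighted:
  assumes mc: "markov_chain M X m K" and K: "K \<in> borel \<rightarrow>\<^sub>M prob_algebra borel"
    and W: "W \<in> borel_measurable (past M X n)" "\<And>\<omega>. 0 \<le> W \<omega>" "\<And>\<omega>. W \<omega> \<le> B"
    and A: "A \<in> sets borel"
  shows "(\<integral>\<omega>. W \<omega> * indicator A (X (Suc n) \<omega>) \<partial>M) = (\<integral>\<omega>. W \<omega> * measure (K (X n \<omega>)) A \<partial>M)"
proof -
  have "prob_space M" and [measurable]: "\<And>n. X n \<in> borel_measurable M"
    and ce: "AE \<omega> in M. real_cond_exp M (past M X n) (indicator (X (Suc n) -` A)) \<omega> = measure (K (X n \<omega>)) A"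
    using mc A by (auto simp: markov_chain_def)
  interpret prob_space M by fact
  have sub: "subalgebra M (past M X n)"
    unfolding subalgebra_def past_def
    by (intro conjI space_vimage_algebra sets_image_in_sets[OF refl] measurable_restrict) auto
  interpret F: finite_measure_subalgebra M "past M X n"
    by unfold_locales (rule sub)
  have WM[measurable]: "W \<in> borel_measurable M"
    by (rule measurable_from_subalg[OF sub W(1)])
  have [measurable]: "A \<in> sets borel" by (rule A)
  have ind: "(indicator (X (Suc n) -` A) :: 'a \<Rightarrow> real) = (\<lambda>\<omega>. indicator A (X (Suc n) \<omega>))"
    by (auto simp: fun_eq_iff indicator_def)
  have indm: "(indicator (X (Suc n) -` A) :: 'a \<Rightarrow> real) \<in> borel_measurable M"
    unfolding ind by measurable
  have WB: "0 \<le> B" using W(2,3) order_trans by blast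
  have "integrable M (\<lambda>\<omega>. W \<omega> * indicator (X (Suc n) -` A) \<omega>)"
    unfolding ind using W WB by (intro integrable_const_bound[where B=B]) (auto simp: indicator_def)
  from F.real_cond_exp_intg(2)[OF this W(1) indm]
  have "(\<integral>\<omega>. W \<omega> * indicator (X (Suc n) -` A) \<omega> \<partial>M)
    = (\<integral>\<omega>. W \<omega> * real_cond_exp M (past M X n) (indicator (X (Suc n) -` A)) \<omega> \<partial>M)" by simp
  also have "\<dots> = (\<integral>\<omega>. W \<omega> * measure (K (X n \<omega>)) A \<partial>M)"
  proof (rule integral_cong_AE)
    show "AE \<omega> in M. W \<omega> * real_cond_exp M (past M X n) (indicator (X (Suc n) -` A)) \<omega> = W \<omega> * measure (K (X n \<omega>)) A"
      using ce by eventually_elim simp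
    note measure_kernel_measurable[OF K A, measurable]
    show "(\<lambda>\<omega>. W \<omega> * measure (K (X n \<omega>)) A) \<in> borel_measurable M" by measurable
  qed auto
  finally show ?thesis unfolding ind .
qed

text \<open>The index starts at 1, as in the optimal filter: \<open>X 0\<close> carries no weight,
  and at time 0 the weighted law is the initial distribution.\<close>

definition path_weight :: "(nat \<Rightarrow> 'e \<Rightarrow> real) \<Rightarrow> (nat \<Rightarrow> 'w \<Rightarrow> 'e) \<Rightarrow> nat \<Rightarrow> 'w \<Rightarrow> real" where
  "path_weight w X n \<omega> = (\<Prod>k=1..n. w k (X k \<omega>))"

lemma path_weight_Suc: "path_weight w X (Suc n) \<omega> = path_weight w X n \<omega> * w (Suc n) (X (Suc n) \<omega>)"
  by (simp add: path_weight_def mult.commute)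

lemma path_weight_bounds:
  assumes "\<And>k x. 0 < w k x" "\<And>k x. w k x \<le> B k"
  shows "0 < path_weight w X n \<omega>" "path_weight w X n \<omega> \<le> (\<Prod>k=1..n. B k)"
proof -
  show "0 < path_weight w X n \<omega>" unfolding path_weight_def by (intro prod_pos) (simp add: assms)
  show "path_weight w X n \<omega> \<le> (\<Prod>k=1..n. B k)"
    unfolding path_weight_def by (intro prod_mono) (simp add: assms less_imp_le)
qed

lemma path_weight_past:
  assumes [measurable]: "\<And>k. w k \<in> borel_measurable borel"
  shows "path_weight w X n \<in> borel_measurable (past M X n)"
proof -
  have "X k \<in> borel_measurable (past M X n)" if "k \<in> {1..n}" for k
    using that by (intro past_measurable_component) auto
  then have "(\<lambda>\<omega>. w k (X k \<omega>)) \<in> borel_measurable (past M X n)" if "k \<in> {1..n}" for k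
    using that by (intro measurable_compose[OF _ assms])
  then show ?thesis unfolding path_weight_def[abs_def] by (rule borel_measurable_prod)
qed

text \<open>The observations are frozen inside \<open>w\<close>, where \<open>w k\<close> stands for
  the likelihood of the k-th one. Everything proved here therefore holds path by path.\<close>

locale weighted_chain =
  fixes M :: "'w measure" and X :: "nat \<Rightarrow> 'w \<Rightarrow> 'e::polish_space" and m K
    and w :: "nat \<Rightarrow> 'e \<Rightarrow> real" and B :: "nat \<Rightarrow> real"
  assumes chain: "markov_chain M X m K"
    and kernel: "K \<in> borel \<rightarrow>\<^sub>M prob_algebra borel"
    and w_measurable[measurable]: "\<And>k. w k \<in> borel_measurable borel"
    and w_pos: "\<And>k x. 0 < w k x" and w_le: "\<And>k x. w k x \<le> B k"
begin

sublocale prob_space M using chain by (simp add: markov_chain_def)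

lemma X_measurable[measurable]: "X n \<in> borel_measurable M"
  using chain by (simp add: markov_chain_def)

lemma path_weight_measurable[measurable]: "path_weight w X n \<in> borel_measurable M"
  unfolding path_weight_def[abs_def] by measurable

abbreviation "filtered n \<equiv> weighted_law M (X n) (path_weight w X n)"

abbreviation "predicted n \<equiv> weighted_law M (X (Suc n)) (path_weight w X n)"

lemmas law = weighted_law[OF finite_measure_axioms X_measurable path_weight_measurable
    less_imp_le[OF path_weight_bounds(1)[OF w_pos w_le]] path_weight_bounds(2)[OF w_pos w_le]]

lemma measure_prediction:
  assumes A: "A \<in> sets borel"
  shows "measure (predicted n) A = (\<integral>x. measure (K x) A \<partial>filtered n)"
  using markov_chain_weighted[OF chain kernel path_weight_past[OF w_measurable]
      less_imp_le[OF path_weight_bounds(1)[OF w_pos w_le]] path_weight_bounds(2)[OF w_pos w_le] A]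
  by (simp add: law(4)[OF A] law(3)[OF measure_kernel_measurable[OF kernel A]])

lemma measure_update:
  assumes A: "A \<in> sets borel"
  shows "measure (filtered (Suc n)) A = (\<integral>x. indicator A x * w (Suc n) x \<partial>predicted n)"
  using A by (subst law(3)) (auto simp: law(4) path_weight_Suc mult_ac)

text \<open>The weight is positive but has no uniform positive lower bound; a vanishing integral
  would make it vanish almost everywhere.\<close>

lemma mass_pos: "0 < measure (filtered n) (space (filtered n))"
proof -
  have sp: "space (filtered n) = UNIV" using sets_eq_imp_space_eq[OF law(2)] by simp
  have int: "integrable M (path_weight w X n)"
    using path_weight_bounds[of w B, OF w_pos w_le, of X n]
    by (intro integrable_const_bound[where B="\<Prod>k=1..n. B k"]) (auto simp: abs_of_pos)
  have "measure (filtered n) (space (filtered n)) = (\<integral>\<omega>. path_weight w X n \<omega> \<partial>M)"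
    by (simp add: sp law(4))
  moreover have "\<dots> \<noteq> 0"
  proof
    assume "(\<integral>\<omega>. path_weight w X n \<omega> \<partial>M) = 0"
    then have "AE \<omega> in M. path_weight w X n \<omega> = 0"
      using path_weight_bounds(1)[of w B, OF w_pos w_le, of X n]
      by (subst (asm) integral_nonneg_eq_0_iff_AE[OF int]) (auto simp: less_imp_le)
    then have "AE \<omega> in M. False"
      by eventually_elim (use path_weight_bounds(1)[of w B, OF w_pos w_le, of X n] in \<open>simp add: less_imp_neq[symmetric]\<close>)
    then show False by simp
  qed
  ultimately show ?thesis using measure_nonneg[of "filtered n" "space (filtered n)"] by linarith
qed

end

text \<open>Induction on time, with \<open>1 + r\<close> as an invariant: the second condition on
  \<open>r\<close> says that contraction by the mixing kernel \<open>K2\<close> outweighs the cost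
  of having \<open>K1\<close> in the first filter.\<close>

lemma comparable_filters:
  assumes A: "weighted_chain M1 X m K1 w B" and B: "weighted_chain M2 X m K2 w B"
    and lam: "\<And>x A. A \<in> sets borel \<Longrightarrow> \<epsilon> * measure lam A \<le> measure (K2 x) A"
      "\<And>x A. A \<in> sets borel \<Longrightarrow> measure (K2 x) A \<le> 1 / \<epsilon> * measure lam A"
    and \<epsilon>: "0 < \<epsilon>" "\<epsilon> \<le> 1"
    and ratio: "\<And>x A. A \<in> sets borel \<Longrightarrow> measure (K1 x) A \<le> exp c * measure (K2 x) A"
      "\<And>x A. A \<in> sets borel \<Longrightarrow> measure (K2 x) A \<le> exp c * measure (K1 x) A"
    and r: "0 \<le> r" "exp (2 * c) * (1 + (1 - \<epsilon>\<^sup>2) * r) \<le> 1 + r"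
  shows "comparable (1 + r) (weighted_law M1 (X n) (path_weight w X n))
           (weighted_law M2 (X n) (path_weight w X n))"
proof -
  interpret A: weighted_chain M1 X m K1 w B by fact
  interpret B: weighted_chain M2 X m K2 w B by fact
  show ?thesis
  proof (induction n)
    \<comment> \<open>The weight is an empty product, so both laws equal \<open>m\<close> and the
      factor 1 serves.\<close>
    case 0
    have "measure (A.filtered 0) C = measure (B.filtered 0) C" if C: "C \<in> sets borel" for C
    proof -
      have "measure (weighted_law N (X 0) (path_weight w X 0)) C = measure m C"
        if N: "weighted_chain N X m L w B" for N L
      proof -
        interpret N: weighted_chain N X m L w B by fact
        have "weighted_law N (X 0) (path_weight w X 0) = distr N borel (X 0)"
          unfolding weighted_law_def path_weight_def by (simp add: density_1)
        then show ?thesis using N.chain by (simp add: markov_chain_def)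
      qed
      from this[OF A] this[OF B] show ?thesis by simp
    qed
    then show ?case unfolding comparable_def B.law(2)
      using r(1) by (intro exI[of _ 1]) (auto simp: algebra_simps)
  next
    case (Suc n)
    have K2m: "(\<lambda>x. measure (K2 x) C) \<in> borel_measurable (B.filtered n)"
      and K2m': "(\<lambda>x. measure (K2 x) C) \<in> borel_measurable (A.filtered n)"
      and K1m: "(\<lambda>x. measure (K1 x) C) \<in> borel_measurable (A.filtered n)" if "C \<in> sets borel" for C
      using that measure_kernel_measurable[OF A.kernel] measure_kernel_measurable[OF B.kernel]
      by (simp_all cong: measurable_cong_sets add: A.law(2) B.law(2))
    have pk: "prob_space (K1 x)" "prob_space (K2 x)" for x
      using measurable_space[OF A.kernel, of x] measurable_space[OF B.kernel, of x]
      by (auto simp: space_prob_algebra)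
    interpret Au: finite_measure "A.filtered n" by (rule A.law)
    have int: "integrable (A.filtered n) (\<lambda>x. measure (K1 x) C)" "integrable (A.filtered n) (\<lambda>x. measure (K2 x) C)"
      if "C \<in> sets borel" for C
      using K1m[OF that] K2m'[OF that] pk
      by (auto intro!: Au.integrable_const_bound[where B=1] AE_I2 prob_space.prob_le_1)
    \<comment> \<open>Prediction: both filters are measured against \<open>K2\<close>. For the
      second this is exact, for the first it costs \<open>exp c\<close> in each direction by
      \<open>ratio\<close>.\<close>
    have cv: "comparable (1 + r) (A.predicted n) (B.predicted n)"
    proof (rule comparable_step[OF Suc, where F="\<lambda>C x. measure (K2 x) C" and lam="measure lam" and \<epsilon>=\<epsilon> and c=c])
      show "measure (A.predicted n) C \<le> exp c * (\<integral>x. measure (K2 x) C \<partial>A.filtered n)" if "C \<in> sets (B.filtered n)" for C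
      proof -
        have C: "C \<in> sets borel" using that by (simp add: B.law)
        have "measure (A.predicted n) C \<le> (\<integral>x. exp c * measure (K2 x) C \<partial>A.filtered n)"
          unfolding A.measure_prediction[OF C] using int[OF C] ratio(1)[OF C]
          by (intro integral_mono) auto
        then show ?thesis by simp
      qed
      show "(\<integral>x. measure (K2 x) C \<partial>A.filtered n) \<le> exp c * measure (A.predicted n) C" if "C \<in> sets (B.filtered n)" for C
      proof -
        have C: "C \<in> sets borel" using that by (simp add: B.law)
        have "(\<integral>x. measure (K2 x) C \<partial>A.filtered n) \<le> (\<integral>x. exp c * measure (K1 x) C \<partial>A.filtered n)"
          using int[OF C] ratio(2)[OF C] by (intro integral_mono) auto
        then show ?thesis by (simp add: A.measure_prediction[OF C])
      qed
      show "measure (B.predicted n) C = (\<integral>x. measure (K2 x) C \<partial>B.filtered n)" if "C \<in> sets (B.filtered n)" for C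
        using that by (intro B.measure_prediction) (simp add: B.law)
    qed (use r \<epsilon> lam K2m B.mass_pos A.law(1) B.law(1) in \<open>auto simp: A.law(2) B.law(2)\<close>)
    \<comment> \<open>Update: both predictors are weighted by the same likelihood, which preserves
      the constant.\<close>
    show ?case
    proof (rule comparable_density[OF cv, where w="w (Suc n)" and B="B (Suc n)"])
      show "w (Suc n) \<in> borel_measurable (B.predicted n)"
        using A.w_measurable by (simp cong: measurable_cong_sets add: B.law(2))
      show "0 \<le> w (Suc n) x" for x using A.w_pos by (rule less_imp_le)
    qed (use r A.w_le A.law(1) B.law(1) A.measure_update B.measure_update in \<open>auto simp: A.law(2) B.law(2)\<close>)
  qed
qed

section \<open>The hidden Markov model\<close>

lemma noise_density_measurable [measurable]:
  "noise_density \<sigma> \<in> borel_measurable (borel :: (real ^ 'd) measure)"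
  unfolding noise_density_def[abs_def] by measurable

lemma noise_density_pos: "0 < \<sigma> \<Longrightarrow> 0 < noise_density \<sigma> z"
  unfolding noise_density_def by (intro prod_pos) (simp add: normal_density_pos)

lemma noise_density_le:
  fixes z :: "real ^ 'd"
  shows "noise_density \<sigma> z \<le> (1 / sqrt (2 * pi * \<sigma>\<^sup>2)) ^ CARD('d)"
proof -
  have "noise_density \<sigma> z \<le> (\<Prod>i\<in>(UNIV :: 'd set). 1 / sqrt (2 * pi * \<sigma>\<^sup>2))"
    unfolding noise_density_def
  proof (intro prod_mono conjI)
    fix i
    show "normal_density 0 \<sigma> (z $ i) \<le> 1 / sqrt (2 * pi * \<sigma>\<^sup>2)"
      unfolding normal_density_def by (intro mult_left_le) auto
  qed simp
  then show ?thesis by simp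
qed

definition likelihood :: "('e \<Rightarrow> real ^ 'd) \<Rightarrow> real \<Rightarrow> (nat \<Rightarrow> real ^ 'd) \<Rightarrow> nat \<Rightarrow> 'e \<Rightarrow> real" where
  "likelihood h \<sigma> y k x = noise_density \<sigma> (y k - h x)"

text \<open>Both integrals over the path law are pulled back along the path map. Positivity of
  \<open>n\<close> ensures that \<open>n\<close> is an index of the path {1..n}.\<close>

lemma filter_measure_eq:
  fixes h :: "'e::polish_space \<Rightarrow> real ^ 'd"
  assumes chain: "weighted_chain M X m K (likelihood h \<sigma> y) B" and h[measurable]: "h \<in> borel_measurable borel"
    and A[measurable]: "A \<in> sets borel" and n: "0 < n"
  shows "filter_measure M X h \<sigma> n y A =
    measure (weighted_law M (X n) (path_weight (likelihood h \<sigma> y) X n)) A /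
    measure (weighted_law M (X n) (path_weight (likelihood h \<sigma> y) X n)) UNIV"
proof -
  interpret weighted_chain M X m K "likelihood h \<sigma> y" B by fact
  have path[measurable]: "(\<lambda>\<omega>. \<lambda>k\<in>{1..n}. X k \<omega>) \<in> M \<rightarrow>\<^sub>M (\<Pi>\<^sub>M k\<in>{1..n}. borel)"
    by (intro measurable_restrict) auto
  have n1: "n \<in> {1..n}" using n by simp
  have weight[measurable]:
    "(\<lambda>x. \<Prod>k=1..n. noise_density \<sigma> (y k - h (x k))) \<in> borel_measurable (\<Pi>\<^sub>M k\<in>{1..n}. (borel :: 'e measure))"
    by measurable
  have last: "(\<lambda>x. x n) \<in> (\<Pi>\<^sub>M k\<in>{1..n}. (borel :: 'e measure)) \<rightarrow>\<^sub>M borel"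
    by (rule measurable_component_singleton[OF n1])
  have ind: "(\<lambda>x. indicator A (x n) :: real) \<in> borel_measurable (\<Pi>\<^sub>M k\<in>{1..n}. (borel :: 'e measure))"
    using last by measurable
  have num: "(\<integral>x. g (x n) * (\<Prod>k=1..n. noise_density \<sigma> (y k - h (x k))) \<partial>path_law M X n)
      = (\<integral>\<omega>. path_weight (likelihood h \<sigma> y) X n \<omega> * g (X n \<omega>) \<partial>M)"
    if "(\<lambda>x. g (x n)) \<in> borel_measurable (\<Pi>\<^sub>M k\<in>{1..n}. (borel :: 'e measure))" for g
  proof -
    note m = borel_measurable_times[OF that weight]
    show ?thesis
      unfolding path_law_def integral_distr[OF path m]
      using n by (simp add: path_weight_def likelihood_def mult.commute)
  qed
  show ?thesis
    unfolding filter_measure_def optimal_filter_def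
    using num[OF ind] num[of "\<lambda>_. 1"] by (simp add: law(4))
qed

text \<open>The norm adds the positive and the negative variation, each at most \<open>r\<close>;
  hence the factor 2.\<close>

lemma tv_norm_le:
  assumes "\<And>A. A \<in> sets borel \<Longrightarrow> \<bar>\<nu> A\<bar> \<le> r"
  shows "tv_norm \<nu> \<le> ennreal (2 * r)"
proof -
  have r: "0 \<le> r" using assms[of "{}"] by simp
  have "upper_variation \<nu> UNIV \<le> ennreal r" "upper_variation (\<lambda>A. - \<nu> A) UNIV \<le> ennreal r"
    unfolding upper_variation_def using assms by (auto intro!: SUP_least ennreal_leI simp: abs_le_iff)
  then have "tv_norm \<nu> \<le> ennreal r + ennreal r" unfolding tv_norm_def by (rule add_mono)
  then show ?thesis using r by (simp flip: ennreal_plus)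
qed

theorem lemma4p8:
  fixes K :: "'p::banach \<Rightarrow> 'e::polish_space \<Rightarrow> 'e measure"
    and P :: "'e measure \<Rightarrow> 'p \<Rightarrow> 'w measure"
    and X :: "nat \<Rightarrow> 'w \<Rightarrow> 'e"
    and V :: "nat \<Rightarrow> 'w \<Rightarrow> real ^ 'd"
    and h :: "'e \<Rightarrow> real ^ 'd"
    and \<sigma> :: real
    and \<mu>_lim :: "'p \<Rightarrow> 'e measure"
    and L :: "'p \<Rightarrow> 'p \<Rightarrow> 'e \<Rightarrow> 'e set \<Rightarrow> real"
    and l :: "'p \<Rightarrow> 'p \<Rightarrow> 'e \<Rightarrow> 'e \<Rightarrow> real"
    and \<alpha> :: 'p
    and N :: "'p set"
    and \<mu> \<mu>' :: "'e measure"
  assumes feller: "\<And>\<theta>. feller_kernel (K \<theta>)"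
    and mixing: "\<And>\<theta>. mixing_kernel (K \<theta>)"
    and \<sigma>: "0 < \<sigma>"
    and h: "h \<in> bcontfun"
    and model: "\<And>m \<theta>. m \<in> space (prob_algebra borel) \<Longrightarrow>
                  hidden_markov_model (P m \<theta>) X V m (K \<theta>) \<sigma>"
    and limiting: "\<And>\<theta>. limiting_distribution (\<lambda>m. P m \<theta>) X (\<mu>_lim \<theta>)"
    and deriv: "\<And>\<theta>. weak_frechet_derivative K \<theta> (L \<theta>)"
    and \<mu>: "\<mu> \<in> space (prob_algebra borel)"
    and \<mu>': "\<mu>' \<in> space (prob_algebra borel)"
    and nbhd: "open N" "\<alpha> \<in> N"
    and well_defined: "\<And>\<theta>. \<theta> \<in> N \<Longrightarrow> Lambda_well_defined (L \<theta>) (K \<theta>) (l \<theta>)"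
    and Lambda_bound:
      "(SUP n\<in>{0<..}. SUP \<theta>\<in>N. SUP \<theta>'\<in>N.
          ennreal_root (n + 1)
            (\<integral>\<^sup>+\<omega>. (\<integral>\<^sup>+y. Lambda_fun (l \<theta>') y ^ (n + 1) \<partial>K \<theta>' (X (n - 1) \<omega>)) \<partial>P \<mu> \<theta>)) < \<infinity>"
    and mixing_\<alpha>: "mixing_kernel (K \<alpha>)"
    and moments: "\<And>k. k \<in> {1, 2} \<Longrightarrow>
        integrable (observation_limit h \<sigma> (\<mu>_lim \<alpha>)) (\<lambda>y. norm y ^ k)"
  shows "((\<lambda>\<theta>. SUP n\<in>{0<..}.
            \<integral>\<^sup>+\<omega>. tv_norm (\<lambda>A.
                filter_measure (P \<mu> \<theta>) X h \<sigma> n (\<lambda>k. observation h X V k \<omega>) A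
              - filter_measure (P \<mu> \<alpha>) X h \<sigma> n (\<lambda>k. observation h X V k \<omega>) A) \<partial>P \<mu>' \<alpha>)
          \<longlongrightarrow> 0) (at \<alpha>)"
proof -

  \<comment> \<open>The model as a weighted chain, for every fixed observation path\<close>
  have chain: "markov_chain (P m \<theta>) X m (K \<theta>)" if "m \<in> space (prob_algebra borel)" for m \<theta>
    using model[OF that] by (simp add: hidden_markov_model_def)
  then have prob: "prob_space (P m \<theta>)" if "m \<in> space (prob_algebra borel)" for m \<theta>
    using that by (auto simp: markov_chain_def)
  have K: "K \<theta> \<in> borel \<rightarrow>\<^sub>M prob_algebra borel" for \<theta>
    using feller by (simp add: feller_kernel_def)
  have Kx: "sets (K \<theta> x) = sets borel" "prob_space (K \<theta> x)" for \<theta> x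
    using measurable_space[OF K, of x \<theta>] by (auto simp: space_prob_algebra)
  have Kfin: "finite_measure (K \<theta> x)" for \<theta> x using Kx(2) by (simp add: prob_space_def)
  have bm: "f \<in> borel_measurable borel" if "f \<in> bcontfun" for f :: "'e \<Rightarrow> 'x::metric_space"
    using that by (auto simp: bcontfun_def intro: borel_measurable_continuous_onI)
  have hm: "h \<in> borel_measurable borel" using h by (rule bm)
  \<comment> \<open>The peak value of the Gaussian density, the same at every time.\<close>
  define B where "B k = (1 / sqrt (2 * pi * \<sigma>\<^sup>2)) ^ CARD('d)" for k :: nat
  have wc: "weighted_chain (P \<mu> \<theta>) X \<mu> (K \<theta>) (likelihood h \<sigma> y) B" for \<theta> y
    using chain[OF \<mu>] K noise_density_pos[OF \<sigma>] noise_density_le hm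
    by unfold_locales (auto simp: likelihood_def[abs_def] B_def)

  \<comment> \<open>Essential bound on \<Lambda> and on the derivative kernel\<close>
  define J where "J n \<theta> \<theta>' = ennreal_root (n + 1)
    (\<integral>\<^sup>+\<omega>. (\<integral>\<^sup>+y. Lambda_fun (l \<theta>') y ^ (n + 1) \<partial>K \<theta>' (X (n - 1) \<omega>)) \<partial>P \<mu> \<theta>)" for n \<theta> \<theta>'
  \<comment> \<open>\<open>enn2real\<close> would send an infinite supremum to 0;
    \<open>Lambda_bound\<close> rules this out, which gives \<open>CJ\<close>.\<close>
  define C where "C = enn2real (SUP n\<in>{0<..}. SUP \<theta>\<in>N. SUP \<theta>'\<in>N. J n \<theta> \<theta>')"
  have CJ: "ennreal C = (SUP n\<in>{0<..}. SUP \<theta>\<in>N. SUP \<theta>'\<in>N. J n \<theta> \<theta>')" and C0: "0 \<le> C"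
    using Lambda_bound by (simp_all add: C_def J_def)
  \<comment> \<open>The chain runs with parameter \<alpha> in all these moments, while the kernel
    parameter ranges over \<open>N\<close>.\<close>
  have J: "J n \<alpha> \<theta> \<le> ennreal C" if "0 < n" "\<theta> \<in> N" for n \<theta>
    unfolding CJ using that nbhd(2)
    by (intro SUP_upper2[of n] SUP_upper2[of \<alpha>] SUP_upper2[of \<theta>]) auto
  have Lambda: "AE y in K \<theta> x. Lambda_fun (l \<theta>) y \<le> ennreal (C + 1)" if \<theta>: "\<theta> \<in> N" for \<theta> x
  proof (rule mixing_AE_le_of_moment_bound[OF mixing Kx _ prob[OF \<mu>] C0])
    show "Lambda_fun (l \<theta>) \<in> borel_measurable borel"
      using well_defined[OF \<theta>] by (simp add: Lambda_well_defined_def)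
    show "ennreal_root (n + 1) (\<integral>\<^sup>+\<omega>. (\<integral>\<^sup>+y. Lambda_fun (l \<theta>) y ^ (n + 1) \<partial>K \<theta> (X (n - 1) \<omega>)) \<partial>P \<mu> \<alpha>)
        \<le> ennreal C" if "0 < n" for n
      using J[OF that \<theta>] by (simp only: J_def)
  qed
  have bound: "\<bar>signed_integral (L \<theta> v x) f\<bar> \<le> (C + 1) * (\<integral>y. f y \<partial>K \<theta> x)"
    if \<theta>: "\<theta> \<in> N" and v: "norm v = 1" and f: "f \<in> bcontfun" "\<And>x. 0 \<le> f x" for \<theta> v x f
  proof -
    obtain b where b: "\<And>x. norm (f x) \<le> b"
      using f(1) by (auto simp: bcontfun_def bounded_iff)
    show ?thesis
    proof (rule abs_signed_integral_le[OF _ Kx(1) Kfin bm[OF f(1)] f(2)])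
      show "signed_RN_density (L \<theta> v x) (K \<theta> x) (l \<theta> v x)"
        using well_defined[OF \<theta>] by (simp add: Lambda_well_defined_def)
      show "f y \<le> b" for y using b[of y] by simp
      show "AE y in K \<theta> x. \<bar>l \<theta> v x y\<bar> \<le> C + 1"
        using Lambda[OF \<theta>, of x]
      proof eventually_elim
        case (elim y)
        \<comment> \<open>For fixed \<open>x\<close> and unit \<open>v\<close> the chosen version is
          one of the terms of the supremum, at every point \<open>y\<close>.\<close>
        have "ennreal \<bar>l \<theta> v x y\<bar> \<le> Lambda_fun (l \<theta>) y"
          unfolding Lambda_fun_def using v by (auto intro!: SUP_upper2[where i=x] SUP_upper2[where i=v])
        with elim have "ennreal \<bar>l \<theta> v x y\<bar> \<le> ennreal (C + 1)" by (rule order_trans[rotated])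
        then show ?case using C0 by (simp add: ennreal_le_iff del: ennreal_plus ennreal_1)
      qed
    qed
  qed

  \<comment> \<open>Comparison of the kernels near \<alpha>\<close>
  obtain \<delta> where \<delta>: "0 < \<delta>" "ball \<alpha> \<delta> \<subseteq> N" using nbhd by (auto simp: open_contains_ball)
  \<comment> \<open>The Gronwall exponent: the bound \<open>C + 1\<close> on the logarithmic
    derivative times the length of the segment.\<close>
  define c where "c \<theta> = (C + 1) * dist \<alpha> \<theta>" for \<theta>
  have ratio: "measure (K \<theta> x) A \<le> exp (c \<theta>) * measure (K \<alpha> x) A"
      "measure (K \<alpha> x) A \<le> exp (c \<theta>) * measure (K \<theta> x) A"
    if \<theta>: "\<theta> \<in> ball \<alpha> \<delta>" and A: "A \<in> sets borel" for \<theta> x A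
  proof -
    have *: "(\<integral>y. f y \<partial>K \<theta> x) \<le> exp (c \<theta>) * (\<integral>y. f y \<partial>K \<alpha> x)"
      "(\<integral>y. f y \<partial>K \<alpha> x) \<le> exp (c \<theta>) * (\<integral>y. f y \<partial>K \<theta> x)"
      if f: "f \<in> bcontfun" "\<And>x. 0 \<le> f x" for f
      unfolding c_def using bound[OF _ _ f] \<delta>(2)
      by (auto intro!: kernel_integral_ratio[where K=K, OF feller deriv _ \<theta> f(1)])
    show "measure (K \<theta> x) A \<le> exp (c \<theta>) * measure (K \<alpha> x) A"
      using *(1) by (intro measure_le_of_bcontfun_integral_le[OF Kfin Kfin Kx(1) Kx(1) _ _ A]) auto
    show "measure (K \<alpha> x) A \<le> exp (c \<theta>) * measure (K \<theta> x) A"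
      using *(2) by (intro measure_le_of_bcontfun_integral_le[OF Kfin Kfin Kx(1) Kx(1) _ _ A]) auto
  qed

  \<comment> \<open>Bound on the filters, uniform in time\<close>
  obtain \<epsilon> lam where \<epsilon>: "0 < \<epsilon>" "\<epsilon> \<le> 1"
    and lam: "\<And>x A. A \<in> sets borel \<Longrightarrow> \<epsilon> * measure lam A \<le> measure (K \<alpha> x) A"
      "\<And>x A. A \<in> sets borel \<Longrightarrow> measure (K \<alpha> x) A \<le> 1 / \<epsilon> * measure lam A"
    using mixing_\<alpha> unfolding mixing_kernel_def by blast
  let ?F = "\<lambda>\<theta>. SUP n\<in>{0<..}.
            \<integral>\<^sup>+\<omega>. tv_norm (\<lambda>A.
                filter_measure (P \<mu> \<theta>) X h \<sigma> n (\<lambda>k. observation h X V k \<omega>) A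
              - filter_measure (P \<mu> \<alpha>) X h \<sigma> n (\<lambda>k. observation h X V k \<omega>) A) \<partial>P \<mu>' \<alpha>"
  have main: "?F \<theta> \<le> ennreal (2 * r)"
    if \<theta>: "\<theta> \<in> ball \<alpha> \<delta>" and r: "0 < r" "exp (2 * c \<theta>) * (1 + (1 - \<epsilon>\<^sup>2) * r) \<le> 1 + r" for \<theta> r
  proof (rule SUP_least)
    fix n :: nat assume "n \<in> {0<..}"
    then have n: "0 < n" by simp
    interpret prob_space "P \<mu>' \<alpha>" by (rule prob[OF \<mu>'])
    \<comment> \<open>The bound is the same constant for every sequence \<open>y\<close>, so the
      expectation under the probability measure \<open>P \<mu>' \<alpha>\<close> keeps it.\<close>
    have tv: "tv_norm (\<lambda>A. filter_measure (P \<mu> \<theta>) X h \<sigma> n y A - filter_measure (P \<mu> \<alpha>) X h \<sigma> n y A)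
      \<le> ennreal (2 * r)" for y
    proof (rule tv_norm_le)
      fix A :: "'e set" assume A: "A \<in> sets borel"
      interpret a: weighted_chain "P \<mu> \<theta>" X \<mu> "K \<theta>" "likelihood h \<sigma> y" B by (rule wc)
      interpret b: weighted_chain "P \<mu> \<alpha>" X \<mu> "K \<alpha>" "likelihood h \<sigma> y" B by (rule wc)
      have comp: "comparable (1 + r) (a.filtered n) (b.filtered n)"
        using r by (intro comparable_filters[OF wc wc lam \<epsilon> ratio[OF \<theta>]]) auto
      have sp: "space (a.filtered n) = UNIV" "space (b.filtered n) = UNIV"
        using sets_eq_imp_space_eq[OF a.law(2)] sets_eq_imp_space_eq[OF b.law(2)] by simp_all
      have "\<bar>measure (a.filtered n) A / measure (a.filtered n) (space (a.filtered n)) -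
          measure (b.filtered n) A / measure (b.filtered n) (space (b.filtered n))\<bar> \<le> (1 + r) - 1"
        using A r by (intro comparable_normalized_diff[OF comp a.law(1) b.law(1) _ a.mass_pos b.mass_pos])
          (auto simp: a.law(2) b.law(2))
      then show "\<bar>filter_measure (P \<mu> \<theta>) X h \<sigma> n y A - filter_measure (P \<mu> \<alpha>) X h \<sigma> n y A\<bar> \<le> r"
        using filter_measure_eq[OF wc hm A n] by (simp add: sp)
    qed
    have "(\<integral>\<^sup>+\<omega>. tv_norm (\<lambda>A.
        filter_measure (P \<mu> \<theta>) X h \<sigma> n (\<lambda>k. observation h X V k \<omega>) A
      - filter_measure (P \<mu> \<alpha>) X h \<sigma> n (\<lambda>k. observation h X V k \<omega>) A) \<partial>P \<mu>' \<alpha>)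
      \<le> (\<integral>\<^sup>+\<omega>. ennreal (2 * r) \<partial>P \<mu>' \<alpha>)"
      by (intro nn_integral_mono tv)
    then show "(\<integral>\<^sup>+\<omega>. tv_norm (\<lambda>A.
        filter_measure (P \<mu> \<theta>) X h \<sigma> n (\<lambda>k. observation h X V k \<omega>) A
      - filter_measure (P \<mu> \<alpha>) X h \<sigma> n (\<lambda>k. observation h X V k \<omega>) A) \<partial>P \<mu>' \<alpha>) \<le> ennreal (2 * r)"
      by (simp add: emeasure_space_1)
  qed

  \<comment> \<open>The limit in the parameter\<close>
  show ?thesis
  proof (rule order_tendstoI)
    fix a :: ennreal assume "0 < a"
    \<comment> \<open>\<open>a\<close> may be infinite; \<open>e\<close> is a finite positive number
      below it.\<close>
    then obtain e where e: "0 < e" "e < a" using dense by blast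
    then obtain s where s: "e = ennreal s" "0 < s"
      by (cases e) (auto simp: ennreal_less_zero_iff)
    \<comment> \<open>Halved because \<open>main\<close> bounds the total variation by
      \<open>2 * r\<close>.\<close>
    define r where "r = s / 2"
    have r: "0 < r" "ennreal (2 * r) < a" using e s by (auto simp: r_def)
    have "((\<lambda>\<theta>. exp (2 * c \<theta>) * (1 + (1 - \<epsilon>\<^sup>2) * r)) \<longlongrightarrow>
        exp (2 * ((C + 1) * dist \<alpha> \<alpha>)) * (1 + (1 - \<epsilon>\<^sup>2) * r)) (at \<alpha>)"
      unfolding c_def by (intro tendsto_intros)
    \<comment> \<open>At \<alpha> the exponent vanishes and \<epsilon> > 0 makes the inequality
      strict, so by continuity it persists near \<alpha>.\<close>
    moreover have "exp (2 * ((C + 1) * dist \<alpha> \<alpha>)) * (1 + (1 - \<epsilon>\<^sup>2) * r) < 1 + r"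
      using r \<epsilon> by (simp add: algebra_simps)
    ultimately have "\<forall>\<^sub>F \<theta> in at \<alpha>. exp (2 * c \<theta>) * (1 + (1 - \<epsilon>\<^sup>2) * r) < 1 + r"
      by (rule order_tendstoD(2))
    moreover have "\<forall>\<^sub>F \<theta> in at \<alpha>. \<theta> \<in> ball \<alpha> \<delta>"
      using \<delta>(1) by (intro eventually_at_in_open') auto
    ultimately show "\<forall>\<^sub>F \<theta> in at \<alpha>. ?F \<theta> < a"
    proof eventually_elim
      case (elim \<theta>)
      have "?F \<theta> \<le> ennreal (2 * r)" using elim r(1) by (intro main) auto
      then show ?case using r(2) by (rule le_less_trans)
    qed
  qed simp
qed

end
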